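(* Let $\alpha,\beta\in\mathbb{R}^3$ and $\gamma=\alpha\times\beta$ satisfy $\alpha\cdot m\neq0$, $\beta\cdot m\neq0$, $\gamma\cdot m\neq0$ for every $m\in\mathbb{Z}^3\setminus\{0\}$. Let $\hat{\mathcal{S}}$ be the central extension by $\mathbb{R}^3$ of the Lie algebra $\mathcal{S}$ of incompressible vector fields on $\mathbb{T}^3$, with its invariant inner product $\langle\cdot,\cdot\rangle$ (both defined in the context). For $m\in\mathbb{Z}^3\setminus\{0\}$ put $e_m=e^{im\cdot x}$, $a_m=-\alpha\times\nabla e_m$, $b_m=-\beta\times\nabla e_m$. For $j=1,2,3$ let $c_j$ be the three central basis elements and $d_j$ the three translations along the coordinate axes. Then $a_m,b_m,c_j,d_j$ form a basis of $\hat{\mathcal{S}}$, and the following hold. (1) Commutation relations: for all $m,n\in\mathbb{Z}^3\setminus\{0\}$, $$[a_m,a_n]=\alpha\cdot(m\times n)\,a_{m+n},\qquad [b_m,b_n]=\beta\cdot(m\times n)\,b_{m+n},$$ $$[a_m,b_n]=\frac{\gamma\cdot m}{\gamma\cdot(m+n)}\,\beta\cdot(m\times n)\,a_{m+n}+\frac{\gamma\cdot n}{\gamma\cdot(m+n)}\,\alpha\cdot(m\times n)\,b_{m+n}+\gamma\cdot n\;(c\cdot n)\,\delta(m+n),$$ where $c\cdot n=\sum_j n_jc_j$ and $\delta(m+n)$ is $1$ if $m+n=0$ and $0$ otherwise; every $c_j$ is central; $[d_j,d_k]=0$; and $[d_j,a_m]=im_ja_m$, $[d_j,b_m]=im_jb_m$.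 (2) Inner product: $$\langle a_m,a_n\rangle=\langle a_m,c_j\rangle=0=\langle b_m,b_n\rangle=\langle b_m,d_j\rangle,\qquad \langle a_m,b_n\rangle=i\,\gamma\cdot n\,\delta(m+n),\qquad \langle d_j,c_k\rangle=\delta_{jk}.$$ (3) Put $X_m=a_m$ and $X^n=-\frac{1}{i\gamma\cdot n}\,b_{-n}$, so that $\langle X_m,X^n\rangle=\delta_m^n$. Let $\mathcal{A}$ be spanned by $X_a=(X_m,c_j)$ and $\mathcal{B}$ by $X^a=(X^m,d_j)$. Then $\hat{\mathcal{S}}=\mathcal{A}\oplus\mathcal{B}$ is a splitting into isotropic Lie subalgebras ($\langle\mathcal{A},\mathcal{A}\rangle=0=\langle\mathcal{B},\mathcal{B}\rangle$), i.e. $(\hat{\mathcal{S}},\mathcal{A},\mathcal{B})$ is a Manin triple. The commutation relations have the Lie bi-algebra form $$[X_a,X_b]=\Gamma_{ab}^cX_c,\qquad [X^a,X^b]=\mu^{ab}_cX^c,\qquad [X_a,X^b]=-\Gamma_{ad}^bX^d+\mu_a^{bd}X_d$$ (summation over repeated indices), with $$\Gamma_{mn}^k=\delta_{m+n}^k\,\alpha\cdot(m\times n),\qquad \mu_k^{mn}=\delta_k^{m+n}\,\frac{(-i\gamma\cdot k)}{(i\gamma\cdot m)(i\gamma\cdot n)}\,\beta\cdot(m\times n).$$ Thus $\hat{\mathcal{S}}$ carries a Lie bi-algebra structure.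
   Context: $\mathbb{T}^3$ is the torus of side $2\pi$. $\mathcal{S}$ is the Lie algebra of vector fields $u$ on $\mathbb{T}^3$ with $\nabla\cdot u=0$, under $[u,w]=u\cdot\nabla w-w\cdot\nabla u$. Write $\bar u=\int_{\mathbb{T}^3}u\,\frac{d^3x}{(2\pi)^3}$ and $u'=u-\bar u$. The curl is invertible on divergence-free fields of zero average, and $\mathrm{curl}^{-1}$ is its inverse there. As a vector space $\hat{\mathcal{S}}=\mathbb{R}^3\oplus\mathcal{S}$, with bracket $$[(u,\eta),(w,\mu)]=\big([u,w],\Omega(u,w)\big),\qquad \Omega(u,w)=\int_{\mathbb{T}^3}w\times u\,\frac{d^3x}{(2\pi)^3},$$ and invariant inner product (symmetric, not positive) $$\langle(u,\eta),(w,\mu)\rangle=\int_{\mathbb{T}^3}u'\cdot\mathrm{curl}^{-1}w'\,\frac{d^3x}{(2\pi)^3}+\eta\cdot\bar w+\mu\cdot\bar u.$$ A vector field $u$ is identified with $(u,0)$; with $\epsilon_j$ the standard basis of $\mathbb{R}^3$, $d_j=(\epsilon_j,0)$ (constant vector field) and $c_j=(0,\epsilon_j)$. Since the Fourier elements $a_m,b_m$ are complex, brackets, inner product and spans are extended complex-linearly when they are used; the basis is understood for trigonometric polynomial vector fields. A Manin triple is a Lie algebra with an invariant inner product together with a splitting as a direct sum of two isotropic Lie subalgebras.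
   Formalization: Here γ = β×α, not α×β (with α×β the stated ⟨a_m,b_n⟩ and central term have the wrong sign), and Ω(u,w) is the average of w'×u', not w×u (with w×u, [d_j,d_k] = (0, ε_k×ε_j) ≠ 0). *)

theory Defs
  imports "HOL-Analysis.Analysis" "HOL-Library.Function_Algebras"
begin

section \<open>Lie algebras with an invariant inner product, Manin triples\<close>

definition bilinear_on ::
  "(complex \<Rightarrow> 'v \<Rightarrow> 'v::ab_group_add) \<Rightarrow> (complex \<Rightarrow> 'w \<Rightarrow> 'w::ab_group_add) \<Rightarrow> 'v set
    \<Rightarrow> ('v \<Rightarrow> 'v \<Rightarrow> 'w) \<Rightarrow> bool" where
  "bilinear_on s t V f \<longleftrightarrow>
     (\<forall>x\<in>V. \<forall>y\<in>V. \<forall>z\<in>V. f (x + y) z = f x z + f y z \<and> f z (x + y) = f z x + f z y) \<and>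
     (\<forall>c. \<forall>x\<in>V. \<forall>y\<in>V. f (s c x) y = t c (f x y) \<and> f x (s c y) = t c (f x y))"

definition lie_algebra_on ::
  "(complex \<Rightarrow> 'v \<Rightarrow> 'v::ab_group_add) \<Rightarrow> 'v set \<Rightarrow> ('v \<Rightarrow> 'v \<Rightarrow> 'v) \<Rightarrow> bool" where
  "lie_algebra_on s V br \<longleftrightarrow>
     module.subspace s V \<and>
     (\<forall>x\<in>V. \<forall>y\<in>V. br x y \<in> V) \<and>
     bilinear_on s s V br \<and>
     (\<forall>x\<in>V. br x x = 0) \<and>
     (\<forall>x\<in>V. \<forall>y\<in>V. \<forall>z\<in>V. br x (br y z) + br y (br z x) + br z (br x y) = 0)"

definition invariant_inner_product_on ::
  "(complex \<Rightarrow> 'v \<Rightarrow> 'v::ab_group_add) \<Rightarrow> 'v set \<Rightarrow> ('v \<Rightarrow> 'v \<Rightarrow> 'v) \<Rightarrow> ('v \<Rightarrow> 'v \<Rightarrow> complex) \<Rightarrow> bool"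
  where
  "invariant_inner_product_on s V br ip \<longleftrightarrow>
     bilinear_on s (*) V ip \<and>
     (\<forall>x\<in>V. \<forall>y\<in>V. ip x y = ip y x) \<and>
     (\<forall>x\<in>V. (\<forall>y\<in>V. ip x y = 0) \<longrightarrow> x = 0) \<and>
     (\<forall>x\<in>V. \<forall>y\<in>V. \<forall>z\<in>V. ip (br x y) z = ip x (br y z))"

definition lie_subalgebra_on ::
  "(complex \<Rightarrow> 'v \<Rightarrow> 'v::ab_group_add) \<Rightarrow> 'v set \<Rightarrow> ('v \<Rightarrow> 'v \<Rightarrow> 'v) \<Rightarrow> 'v set \<Rightarrow> bool" where
  "lie_subalgebra_on s V br A \<longleftrightarrow>
     module.subspace s A \<and> A \<subseteq> V \<and> (\<forall>x\<in>A. \<forall>y\<in>A. br x y \<in> A)"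

definition isotropic :: "('v \<Rightarrow> 'v \<Rightarrow> complex) \<Rightarrow> 'v set \<Rightarrow> bool" where
  "isotropic ip A \<longleftrightarrow> (\<forall>x\<in>A. \<forall>y\<in>A. ip x y = 0)"

definition direct_sum_of :: "'v::ab_group_add set \<Rightarrow> 'v set \<Rightarrow> 'v set \<Rightarrow> bool" where
  "direct_sum_of V A B \<longleftrightarrow> V = {x + y | x y. x \<in> A \<and> y \<in> B} \<and> A \<inter> B = {0}"

definition manin_triple ::
  "(complex \<Rightarrow> 'v \<Rightarrow> 'v::ab_group_add) \<Rightarrow> 'v set \<Rightarrow> ('v \<Rightarrow> 'v \<Rightarrow> 'v) \<Rightarrow> ('v \<Rightarrow> 'v \<Rightarrow> complex)
    \<Rightarrow> 'v set \<Rightarrow> 'v set \<Rightarrow> bool" where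
  "manin_triple s V br ip A B \<longleftrightarrow>
     lie_algebra_on s V br \<and> invariant_inner_product_on s V br ip \<and>
     lie_subalgebra_on s V br A \<and> lie_subalgebra_on s V br B \<and>
     isotropic ip A \<and> isotropic ip B \<and> direct_sum_of V A B"

section \<open>Structure constants of a Lie bialgebra\<close>

text \<open>
  A sum over an infinite index set in which only finitely many terms are nonzero. As
  \<open>sum\<close> returns 0 on infinite sets, it is always accompanied by a finiteness statement.
\<close>

definition isum :: "'i set \<Rightarrow> ('i \<Rightarrow> complex) \<Rightarrow> complex" where
  "isum I f = (\<Sum>c | c \<in> I \<and> f c \<noteq> 0. f c)"

definition lincomb ::
  "(complex \<Rightarrow> 'v \<Rightarrow> 'v::ab_group_add) \<Rightarrow> 'i set \<Rightarrow> ('i \<Rightarrow> complex) \<Rightarrow> ('i \<Rightarrow> 'v) \<Rightarrow> 'v" where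
  "lincomb s I f X = (\<Sum>c | c \<in> I \<and> f c \<noteq> 0. s (f c) (X c))"

definition lie_constants :: "'i set \<Rightarrow> ('i \<Rightarrow> 'i \<Rightarrow> 'i \<Rightarrow> complex) \<Rightarrow> bool" where
  "lie_constants I G \<longleftrightarrow>
     (\<forall>a\<in>I. \<forall>b\<in>I. finite {c \<in> I. G a b c \<noteq> 0}) \<and>
     (\<forall>a\<in>I. \<forall>b\<in>I. \<forall>c\<in>I. G a b c = - G b a c) \<and>
     (\<forall>a\<in>I. \<forall>b\<in>I. \<forall>c\<in>I. \<forall>e\<in>I.
        isum I (\<lambda>d. G a b d * G d c e) + isum I (\<lambda>d. G b c d * G d a e)
          + isum I (\<lambda>d. G c a d * G d b e) = 0)"

text \<open>
  \<open>G a b c\<close> stands for the bracket constants (lower indices \<open>a\<close>, \<open>b\<close>, upper index \<open>c\<close>) and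
  \<open>M a b c\<close> for the cobracket constants (upper indices \<open>a\<close>, \<open>b\<close>, lower index \<open>c\<close>). The last
  condition is the 1-cocycle condition for the cobracket sending \<open>X c\<close> to the sum of the
  \<open>M d e c\<close> multiples of the tensors \<open>X d\<close>, \<open>X e\<close>. For fixed \<open>c\<close> this sum may be
  infinite, so the structure is expressed through its constants and not through a map into
  the algebraic tensor square; all sums below are finite.
\<close>

definition lie_bialgebra_constants ::
  "'i set \<Rightarrow> ('i \<Rightarrow> 'i \<Rightarrow> 'i \<Rightarrow> complex) \<Rightarrow> ('i \<Rightarrow> 'i \<Rightarrow> 'i \<Rightarrow> complex) \<Rightarrow> bool" where
  "lie_bialgebra_constants I G M \<longleftrightarrow>
     lie_constants I G \<and> lie_constants I M \<and>
     (\<forall>a\<in>I. \<forall>d\<in>I. finite {c \<in> I. G a c d \<noteq> 0}) \<and>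
     (\<forall>a\<in>I. \<forall>d\<in>I. finite {c \<in> I. M a c d \<noteq> 0}) \<and>
     (\<forall>a\<in>I. \<forall>b\<in>I. \<forall>d\<in>I. \<forall>e\<in>I.
        isum I (\<lambda>c. G a b c * M d e c) =
          isum I (\<lambda>c. G a c d * M c e b) + isum I (\<lambda>c. G a c e * M d c b)
          - isum I (\<lambda>c. G b c d * M c e a) - isum I (\<lambda>c. G b c e * M d c a))"

section \<open>Vector calculus on the torus of side \<open>2 \<pi>\<close>\<close>

text \<open>
  Functions on the torus are \<open>2 \<pi>\<close>-periodic functions on \<open>real^3\<close>. Vector fields are
  complex-valued and \<open>cdot\<close>, \<open>ccross\<close> are complex bilinear (not sesquilinear), so every
  operation below is the complex-linear extension of the one on real fields.
\<close>

type_synonym field = "real^3 \<Rightarrow> complex^3"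

definition cvec :: "real^3 \<Rightarrow> complex^3" where
  "cvec v = (\<chi> i. complex_of_real (v $ i))"

definition rvec :: "int^3 \<Rightarrow> real^3" where
  "rvec m = (\<chi> i. real_of_int (m $ i))"

definition cdot :: "complex^3 \<Rightarrow> complex^3 \<Rightarrow> complex" where
  "cdot u w = (\<Sum>i\<in>UNIV. u $ i * w $ i)"

definition ccross :: "complex^3 \<Rightarrow> complex^3 \<Rightarrow> complex^3" where
  "ccross u w = vector [u$2 * w$3 - u$3 * w$2, u$3 * w$1 - u$1 * w$3, u$1 * w$2 - u$2 * w$1]"

definition pd :: "3 \<Rightarrow> (real^3 \<Rightarrow> 'a::real_normed_vector) \<Rightarrow> real^3 \<Rightarrow> 'a" where
  "pd j f x = frechet_derivative f (at x) (axis j 1)"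

primrec Ck :: "nat \<Rightarrow> field \<Rightarrow> bool" where
  "Ck 0 u \<longleftrightarrow> continuous_on UNIV u"
| "Ck (Suc k) u \<longleftrightarrow> u differentiable_on UNIV \<and> (\<forall>j. Ck k (pd j u))"

definition periodic :: "field \<Rightarrow> bool" where
  "periodic u \<longleftrightarrow> (\<forall>x j. u (x + axis j (2 * pi)) = u x)"

definition grad :: "(real^3 \<Rightarrow> complex) \<Rightarrow> field" where
  "grad f x = (\<chi> j. pd j f x)"

definition divergence :: "field \<Rightarrow> real^3 \<Rightarrow> complex" where
  "divergence u x = (\<Sum>j\<in>UNIV. pd j u x $ j)"

definition curl :: "field \<Rightarrow> field" where
  "curl u x = vector [pd 2 u x $ 3 - pd 3 u x $ 2,
                      pd 3 u x $ 1 - pd 1 u x $ 3,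
                      pd 1 u x $ 2 - pd 2 u x $ 1]"

text \<open>Normalised integral over the torus.\<close>

definition avg :: "(real^3 \<Rightarrow> 'a::euclidean_space) \<Rightarrow> 'a" where
  "avg f = (1 / (2 * pi) ^ 3) *\<^sub>R integral (cbox 0 (\<chi> i. 2 * pi)) f"

definition osc :: "field \<Rightarrow> field" where
  "osc u = (\<lambda>x. u x - avg u)"

definition incompressible :: "field set" where
  "incompressible = {u. (\<forall>k. Ck k u) \<and> periodic u \<and> (\<forall>x. divergence u x = 0)}"

definition curl_inv :: "field \<Rightarrow> field" where
  "curl_inv = inv_into {v \<in> incompressible. avg v = 0} curl"

definition convect :: "field \<Rightarrow> field \<Rightarrow> field" where
  "convect u w x = (\<Sum>j\<in>UNIV. u x $ j *s pd j w x)"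

definition vbracket :: "field \<Rightarrow> field \<Rightarrow> field" where
  "vbracket u w = (\<lambda>x. convect u w x - convect w u x)"

section \<open>The central extension\<close>

type_synonym hat = "field \<times> (complex^3)"

definition hscale :: "complex \<Rightarrow> hat \<Rightarrow> hat" where
  "hscale c U = ((\<lambda>x. c *s fst U x), c *s snd U)"

global_interpretation hat: vector_space hscale
  by unfold_locales
    (auto simp: hscale_def fun_eq_iff vector_add_ldistrib vector_sadd_rdistrib vector_smult_assoc)

text \<open>
  The cocycle is the average of the cross product of the zero-average parts. Without
  removing the averages one would get \<open>(0, ccross (axis k 1) (axis j 1))\<close> as the bracket of
  the translations along axes \<open>j\<close> and \<open>k\<close>, which then would not commute. The choice does
  not affect brackets in which one argument has zero average, nor the Jacobi identity
  (brackets of incompressible fields have zero average), nor invariance of \<open>pairing\<close>.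
\<close>

definition cocycle :: "field \<Rightarrow> field \<Rightarrow> complex^3" where
  "cocycle u w = avg (\<lambda>x. ccross (osc w x) (osc u x))"

definition hbracket :: "hat \<Rightarrow> hat \<Rightarrow> hat" where
  "hbracket U W = (vbracket (fst U) (fst W), cocycle (fst U) (fst W))"

definition pairing :: "hat \<Rightarrow> hat \<Rightarrow> complex" where
  "pairing U W = avg (\<lambda>x. cdot (osc (fst U) x) (curl_inv (osc (fst W)) x))
                 + cdot (snd U) (avg (fst W)) + cdot (snd W) (avg (fst U))"

definition hatS :: "hat set" where
  "hatS = {U. fst U \<in> incompressible}"

definition emode :: "int^3 \<Rightarrow> real^3 \<Rightarrow> complex" where
  "emode m x = exp (\<i> * complex_of_real (rvec m \<bullet> x))"

definition trig_poly :: "field \<Rightarrow> bool" where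
  "trig_poly u \<longleftrightarrow> (\<exists>F k. finite F \<and> u = (\<lambda>x. \<Sum>m\<in>F. emode m x *s k m))"

definition hatS_trig :: "hat set" where
  "hatS_trig = {U \<in> hatS. trig_poly (fst U)}"

section \<open>Fourier elements\<close>

text \<open>
  \<open>fmode \<alpha> m\<close> and \<open>fmode \<beta> m\<close> are the elements \<open>a\<close> and \<open>b\<close> with index \<open>m\<close>; \<open>fmode \<xi> 0\<close>
  vanishes. Since \<open>fmode \<beta> n\<close> is the curl of \<open>cvec \<beta>\<close> times \<open>emode n\<close>, the pairing of
  \<open>fmode \<alpha> m\<close> with \<open>fmode \<beta> (- m)\<close> is \<open>-\<i>\<close> times the scalar product of \<open>\<beta>\<close> with
  \<open>cross3 \<alpha> (rvec m)\<close>, that is \<open>-\<i>\<close> times that of \<open>rvec m\<close> with \<open>cross3 \<beta> \<alpha>\<close>. The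
  vector \<open>\<gamma>\<close> of the commutation relations is therefore \<open>cross3 \<beta> \<alpha>\<close> and not
  \<open>cross3 \<alpha> \<beta>\<close>: only for this orientation is the pairing \<open>\<i>\<close> times that of \<open>\<gamma>\<close> with \<open>rvec (- m)\<close>.
\<close>

definition fmode :: "real^3 \<Rightarrow> int^3 \<Rightarrow> hat" where
  "fmode \<xi> m = ((\<lambda>x. - ccross (cvec \<xi>) (grad (emode m) x)), 0)"

definition transl :: "3 \<Rightarrow> hat" where
  "transl j = ((\<lambda>x. axis j 1), 0)"

definition central :: "3 \<Rightarrow> hat" where
  "central j = ((\<lambda>x. 0), axis j 1)"

definition central_comb :: "int^3 \<Rightarrow> hat" where
  "central_comb n = (\<Sum>j\<in>UNIV. hscale (of_int (n $ j)) (central j))"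

definition basis_of :: "'i set \<Rightarrow> ('i \<Rightarrow> hat) \<Rightarrow> hat set \<Rightarrow> bool" where
  "basis_of I f V \<longleftrightarrow> inj_on f I \<and> hat.independent (f ` I) \<and> hat.span (f ` I) = V"

datatype idx = Mode "int^3" | Axis 3

definition indices :: "idx set" where
  "indices = Mode ` (- {0}) \<union> range Axis"

definition Xlow :: "real^3 \<Rightarrow> idx \<Rightarrow> hat" where
  "Xlow \<alpha> = case_idx (fmode \<alpha>) central"

definition Xup :: "real^3 \<Rightarrow> real^3 \<Rightarrow> idx \<Rightarrow> hat" where
  "Xup \<beta> \<gamma> =
     case_idx (\<lambda>n. hscale (- (1 / (\<i> * of_real (\<gamma> \<bullet> rvec n)))) (fmode \<beta> (- n))) transl"

fun Gam :: "real^3 \<Rightarrow> idx \<Rightarrow> idx \<Rightarrow> idx \<Rightarrow> complex" where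
  "Gam \<alpha> (Mode m) (Mode n) (Mode k) =
     (if k = m + n then of_real (\<alpha> \<bullet> cross3 (rvec m) (rvec n)) else 0)"
| "Gam \<alpha> _ _ _ = 0"

text \<open>
  Upper indices first. The constants with one \<open>Axis\<close> index record the action of the
  translations on the modes.
\<close>

fun Mu :: "real^3 \<Rightarrow> real^3 \<Rightarrow> idx \<Rightarrow> idx \<Rightarrow> idx \<Rightarrow> complex" where
  "Mu \<beta> \<gamma> (Mode m) (Mode n) (Mode k) =
     (if k = m + n
      then (- \<i> * of_real (\<gamma> \<bullet> rvec k))
             / ((\<i> * of_real (\<gamma> \<bullet> rvec m)) * (\<i> * of_real (\<gamma> \<bullet> rvec n)))
           * of_real (\<beta> \<bullet> cross3 (rvec m) (rvec n))
      else 0)"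
| "Mu \<beta> \<gamma> (Axis j) (Mode n) (Mode k) = (if k = n then - \<i> * of_int (n $ j) else 0)"
| "Mu \<beta> \<gamma> (Mode n) (Axis j) (Mode k) = (if k = n then \<i> * of_int (n $ j) else 0)"
| "Mu \<beta> \<gamma> _ _ _ = 0"

end

(*
  On plane waves emode m *s p with p orthogonal to m, the bracket, the cocycle and the inner product
  are explicit expressions in m and p, and trigonometric solenoidal fields are spanned by such waves.
  By multilinearity the Jacobi identity and invariance reduce to vector algebra; invariance comes
  down to the fact that the inner product of [x, y] with z is the totally antisymmetric triple
  product of the amplitudes when the frequencies add up to 0. The inverse curl is well defined
  because a periodic field with zero divergence, curl and average is harmonic, hence 0.

  The families a, c and b, d are dual to each other and isotropic. Linear independence, the
  splitting and nondegeneracy follow from expansion in dual bases. So do the mixed brackets, by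
  invariance, and the bialgebra identities: a contraction of two families of structure constants is
  the inner product of two brackets.
*)
theory Submission
  imports Defs
begin

section \<open>Partial derivatives\<close>

text \<open>\<open>curl_inv\<close> is a choice of preimage made by \<open>inv_into\<close>, so
  nothing is known about the inner product, not even additivity, until the curl is injective on
  fields of zero average. This brings analysis on the torus (symmetry of second derivatives,
  integration by parts) into a proof that is otherwise algebra of amplitudes.

  The amplitudes of divergence-free waves of frequency k \<noteq> 0 form the plane orthogonal to k.
  The vectors k \<times> \<alpha> and k \<times> \<beta> lie in it, and their cross product is k
  scaled by k \<bullet> (\<alpha> \<times> \<beta>), so they form a basis of the plane exactly when
  \<gamma> \<bullet> k \<noteq> 0. Resolving the amplitude of a mixed bracket in this basis at k = m
  + n produces the denominators \<gamma> \<bullet> (m + n); pairing opposite frequencies produces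
  the factor that the dual elements \<open>Xup\<close> divide by.

  The cobracket of one basis element may have infinitely many terms, whereas a bracket has finitely
  many coefficients; contractions read as inner products of brackets therefore stay finite.\<close>

lemma pd_eqI: "(u has_derivative D) (at x) \<Longrightarrow> pd j u x = D (axis j 1)"
  unfolding pd_def using frechet_derivative_at by metis

text \<open>Along a line a partial derivative becomes a one-variable derivative, the form required
  by the fundamental theorem of calculus and the Leibniz rule. The set \<open>S\<close> admits
  one-sided derivatives at end points.\<close>

lemma has_vector_derivative_line_pd:
  fixes u :: "real^3 \<Rightarrow> 'a::real_normed_vector"
  assumes "u differentiable (at (x + t *\<^sub>R axis j 1))"
  shows "((\<lambda>t. u (x + t *\<^sub>R axis j 1)) has_vector_derivative pd j u (x + t *\<^sub>R axis j 1)) (at t within S)"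
proof -
  let ?y = "x + t *\<^sub>R axis j 1"
  define D where "D = frechet_derivative u (at ?y)"
  have D: "(u has_derivative D) (at ?y)"
    using assms by (simp add: D_def frechet_derivative_works)
  have "((\<lambda>t. x + t *\<^sub>R axis j 1) has_derivative (\<lambda>h. h *\<^sub>R axis j 1)) (at t within S)"
    by (auto intro!: derivative_eq_intros)
  from has_derivative_compose[OF this, of u D] D
  have "((\<lambda>t. u (x + t *\<^sub>R axis j 1)) has_derivative (\<lambda>h. D (h *\<^sub>R axis j 1))) (at t within S)"
    by simp
  moreover have "D (h *\<^sub>R axis j 1) = h *\<^sub>R pd j u ?y" for h
    using linear_scale[OF has_derivative_linear[OF D]] pd_eqI[OF D] by metis
  ultimately show ?thesis by (simp add: has_vector_derivative_def)
qed

text \<open>Integrating \<open>pd j f\<close> along direction j recovers a difference of values of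
  \<open>f\<close>. Differentiating this identity under the integral sign in direction i, and then
  with respect to the upper limit, compares the two orders of differentiation.\<close>

lemma pd_commute:
  fixes f :: "real^3 \<Rightarrow> 'a::banach"
  assumes f: "\<And>x. f differentiable (at x)"
    and fi: "\<And>x. pd i f differentiable (at x)"
    and fj: "\<And>x. pd j f differentiable (at x)"
    and fij: "continuous_on UNIV (pd i (pd j f))"
  shows "pd j (pd i f) x = pd i (pd j f) x"
proof -
  let ?p = "\<lambda>s t. x + s *\<^sub>R axis i 1 + t *\<^sub>R axis j (1::real)"
  have cj: "continuous_on S (pd j f)" for S
    using fj by (meson continuous_at_imp_continuous_on differentiable_imp_continuous_within)
  have eq1: "integral {0..t} (\<lambda>\<tau>. pd j f (?p s \<tau>)) = f (?p s t) - f (?p s 0)" if "0 \<le> t" for s t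
    by (rule integral_unique, rule fundamental_theorem_of_calculus[OF that])
      (rule has_vector_derivative_line_pd[OF f])
  have swap: "?p s t = (x + t *\<^sub>R axis j 1) + s *\<^sub>R axis i 1" for s t by simp
  have eq2: "integral {0..t} (\<lambda>\<tau>. pd i (pd j f) (?p 0 \<tau>)) = pd i f (?p 0 t) - pd i f (?p 0 0)"
    if t: "0 \<le> t" for t
  proof -
    have "((\<lambda>s. integral (cbox 0 t) (\<lambda>\<tau>. pd j f (?p s \<tau>))) has_vector_derivative
        integral (cbox 0 t) (\<lambda>\<tau>. pd i (pd j f) (?p 0 \<tau>))) (at 0 within UNIV)"
    proof (rule leibniz_rule_vector_derivative)
      show "((\<lambda>s. pd j f (?p s \<tau>)) has_vector_derivative pd i (pd j f) (?p s \<tau>)) (at s within UNIV)"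
        for s \<tau>
        unfolding swap by (rule has_vector_derivative_line_pd[OF fj])
      show "(\<lambda>\<tau>. pd j f (?p s \<tau>)) integrable_on cbox 0 t" for s
        by (intro integrable_continuous continuous_on_compose2[OF cj[of UNIV]] continuous_intros) auto
      show "continuous_on (UNIV \<times> cbox 0 t) (\<lambda>(s, \<tau>). pd i (pd j f) (?p s \<tau>))"
        unfolding split_beta
        by (intro continuous_on_compose2[OF fij] continuous_intros) auto
    qed auto
    moreover have "((\<lambda>s. f (?p s t) - f (?p s 0)) has_vector_derivative
        pd i f (?p 0 t) - pd i f (?p 0 0)) (at 0 within UNIV)"
      unfolding swap
      by (intro has_vector_derivative_diff has_vector_derivative_line_pd f)
    ultimately show ?thesis
      using eq1[OF t] by (simp add: vector_derivative_unique_at)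
  qed
  have c: "continuous_on S (\<lambda>\<tau>. pd i (pd j f) (?p 0 \<tau>))" for S
    by (intro continuous_on_compose2[OF fij] continuous_intros) auto
  \<comment> \<open>\<open>eq2\<close> covers only 0 \<le> t, so both derivatives at t = 0 are taken
    within \<open>{0..1}\<close>, where they are still unique.\<close>
  have "((\<lambda>t. integral {0..t} (\<lambda>\<tau>. pd i (pd j f) (?p 0 \<tau>))) has_vector_derivative
      pd i (pd j f) (?p 0 0)) (at 0 within {0..1})"
    by (rule integral_has_vector_derivative[OF c]) auto
  moreover have "((\<lambda>t. pd i f (?p 0 t) - pd i f (?p 0 0)) has_vector_derivative
      pd j (pd i f) (?p 0 0)) (at 0 within {0..1})"
  proof -
    have "((\<lambda>t. pd i f (?p 0 t)) has_vector_derivative pd j (pd i f) (?p 0 0)) (at 0 within {0..1})"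
      by (rule has_vector_derivative_line_pd) (rule fi)
    from has_vector_derivative_diff[OF this has_vector_derivative_const[of "pd i f (?p 0 0)"]]
    show ?thesis by simp
  qed
  then have "((\<lambda>t. integral {0..t} (\<lambda>\<tau>. pd i (pd j f) (?p 0 \<tau>))) has_vector_derivative
      pd j (pd i f) (?p 0 0)) (at 0 within {0..1})"
    by (rule has_vector_derivative_transform[rotated 2]) (use eq2 in auto)
  ultimately have "pd i (pd j f) (?p 0 0) = pd j (pd i f) (?p 0 0)"
    by (intro vector_derivative_unique_within_closed_interval[of 0 1 0]) (auto simp: cbox_interval)
  then show ?thesis by simp
qed

section \<open>Rules for partial derivatives\<close>

lemma has_derivative_frechet:
  "f differentiable (at x) \<Longrightarrow> (f has_derivative frechet_derivative f (at x)) (at x)"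
  by (simp add: frechet_derivative_works)

lemma pd_const [simp]: "pd j (\<lambda>x. c) = (\<lambda>x. 0)"
  by (rule ext, rule pd_eqI) (auto intro!: derivative_eq_intros)

lemma pd_bounded_linear:
  assumes "bounded_linear h" "u differentiable (at x)"
  shows "pd j (\<lambda>y. h (u y)) x = h (pd j u x)"
  using pd_eqI[OF bounded_linear.has_derivative[OF assms(1) has_derivative_frechet[OF assms(2)]]]
  by (simp add: pd_def)

lemma pd_add:
  assumes "u differentiable (at x)" "w differentiable (at x)"
  shows "pd j (\<lambda>y. u y + w y) x = pd j u x + pd j w x"
  using pd_eqI[OF has_derivative_add[OF assms[THEN has_derivative_frechet]]] by (simp add: pd_def)

lemma pd_diff:
  assumes "u differentiable (at x)" "w differentiable (at x)"
  shows "pd j (\<lambda>y. u y - w y) x = pd j u x - pd j w x"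
  using pd_eqI[OF has_derivative_diff[OF assms[THEN has_derivative_frechet]]] by (simp add: pd_def)

lemma pd_sum:
  assumes "\<And>i. i \<in> I \<Longrightarrow> u i differentiable (at x)"
  shows "pd j (\<lambda>y. \<Sum>i\<in>I. u i y) x = (\<Sum>i\<in>I. pd j (u i) x)"
  using pd_eqI[OF has_derivative_sum[where f = u, OF assms[THEN has_derivative_frechet]]]
  by (simp add: pd_def)

lemma pd_inner:
  fixes u w :: "real^3 \<Rightarrow> 'a::real_inner"
  assumes "u differentiable (at x)" "w differentiable (at x)"
  shows "pd j (\<lambda>y. u y \<bullet> w y) x = u x \<bullet> pd j w x + pd j u x \<bullet> w x"
  using pd_eqI[OF has_derivative_inner[OF assms[THEN has_derivative_frechet]]] by (simp add: pd_def)

lemma pd_periodic: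
  assumes "\<And>x. u differentiable (at x)" "\<And>x. u (x + a) = u x"
  shows "pd j u (x + a) = pd j u x"
proof -
  have "((\<lambda>t. u (x + a + t *\<^sub>R axis j 1)) has_vector_derivative pd j u (x + a + 0 *\<^sub>R axis j 1)) (at 0)"
    "((\<lambda>t. u (x + t *\<^sub>R axis j 1)) has_vector_derivative pd j u (x + 0 *\<^sub>R axis j 1)) (at 0)"
    by (rule has_vector_derivative_line_pd[OF assms(1)])+
  moreover have "u (x + a + t *\<^sub>R axis j 1) = u (x + t *\<^sub>R axis j 1)" for t
    using assms(2)[of "x + t *\<^sub>R axis j 1"] by (simp add: algebra_simps)
  ultimately show ?thesis
    using vector_derivative_unique_at by fastforce
qed

text \<open>In finite dimension real bilinearity already implies boundedness, and bounded linearity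
  is what \<open>pd_bounded_linear\<close> and \<open>avg_linear\<close> ask for.\<close>

lemma bounded_bilinear_vector_smult:
  "bounded_bilinear ((*s) :: complex \<Rightarrow> complex^'n \<Rightarrow> complex^'n)"
  unfolding bilinear_conv_bounded_bilinear[symmetric] bilinear_def
  by (auto intro!: linearI simp: vec_eq_iff algebra_simps)

lemmas bounded_linear_vector_smult = bounded_bilinear.bounded_linear_right[OF bounded_bilinear_vector_smult]

lemma bounded_bilinear_cdot: "bounded_bilinear cdot"
  unfolding bilinear_conv_bounded_bilinear[symmetric] bilinear_def cdot_def
  by (auto intro!: linearI simp: sum_3 algebra_simps)

lemma bounded_bilinear_ccross: "bounded_bilinear ccross"
  unfolding bilinear_conv_bounded_bilinear[symmetric] bilinear_def ccross_def
  by (auto intro!: linearI simp: vec_eq_iff forall_3 algebra_simps)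

subsection \<open>Smooth fields\<close>

lemma Ck_continuous: "Ck k u \<Longrightarrow> continuous_on UNIV u"
  by (cases k) (auto simp: differentiable_imp_continuous_on)

lemma smooth_pd: "(\<And>k. Ck k u) \<Longrightarrow> Ck k (pd j u)"
  by (metis Ck.simps(2))

lemma smooth_differentiable: "(\<And>k. Ck k u) \<Longrightarrow> u differentiable (at x)"
  by (metis Ck.simps(2) UNIV_I differentiable_on_def)

lemma Ck_linear:
  assumes "bounded_linear h"
  shows "Ck k u \<Longrightarrow> Ck k (\<lambda>x. h (u x))"
proof (induction k arbitrary: u)
  case 0
  then show ?case by (simp add: bounded_linear.continuous_on[OF assms])
next
  case (Suc k)
  then have d: "u differentiable (at x)" for x by (simp add: differentiable_on_def)
  then have "pd j (\<lambda>x. h (u x)) = (\<lambda>x. h (pd j u x))" for j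
    by (intro ext pd_bounded_linear assms)
  moreover have "(\<lambda>x. h (u x)) differentiable_on UNIV"
    using d bounded_linear.has_derivative[OF assms] unfolding differentiable_on_def differentiable_def
    by blast
  ultimately show ?case using Suc by simp
qed

lemma Ck_add: "Ck k u \<Longrightarrow> Ck k w \<Longrightarrow> Ck k (\<lambda>x. u x + w x)"
proof (induction k arbitrary: u w)
  case 0
  then show ?case by (simp add: continuous_on_add)
next
  case (Suc k)
  then have "u differentiable (at x)" "w differentiable (at x)" for x
    by (simp_all add: differentiable_on_def)
  then have "pd j (\<lambda>x. u x + w x) = (\<lambda>x. pd j u x + pd j w x)" for j
    by (intro ext pd_add)
  then show ?case using Suc by (simp add: differentiable_on_def)
qed

section \<open>Incompressible fields as a complex vector space\<close>

lemma incompressibleD: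
  assumes "u \<in> incompressible"
  shows "Ck k u" "u (x + axis j (2 * pi)) = u x" "divergence u x = 0"
    "u differentiable (at x)" "continuous_on UNIV u"
  using assms smooth_differentiable[of u x] Ck_continuous[of 0 u]
  unfolding incompressible_def periodic_def by blast+

lemma incompressible_add:
  assumes "u \<in> incompressible" "w \<in> incompressible"
  shows "(\<lambda>x. u x + w x) \<in> incompressible"
proof -
  have "divergence (\<lambda>x. u x + w x) x = divergence u x + divergence w x" for x
    by (simp add: divergence_def pd_add incompressibleD assms sum.distrib)
  then show ?thesis
    using assms by (auto simp: incompressible_def periodic_def intro: Ck_add)
qed

lemma incompressible_scale:
  assumes "u \<in> incompressible"
  shows "(\<lambda>x. c *s u x) \<in> incompressible"
proof -
  have "divergence (\<lambda>x. c *s u x) x = c * divergence u x" for x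
    by (simp add: divergence_def pd_bounded_linear[OF bounded_linear_vector_smult] incompressibleD assms
        sum_distrib_left)
  then show ?thesis
    using assms by (auto simp: incompressible_def periodic_def intro: Ck_linear[OF bounded_linear_vector_smult])
qed

section \<open>Integration over the torus\<close>

abbreviation torus_box :: "(real^3) set" where
  "torus_box \<equiv> cbox 0 (\<chi> i. 2 * pi)"

text \<open>The shifted box is cut at the hyperplane where coordinate j equals 2 \<pi>; only the
  part beyond it has to be moved, and periodicity allows that.\<close>

lemma integral_torus_translate:
  fixes g :: "real^3 \<Rightarrow> 'a::euclidean_space"
  assumes c: "continuous_on UNIV g"
    and p: "\<And>x. g (x + axis j (2 * pi)) = g x"
    and t: "0 \<le> t" "t \<le> 2 * pi"
  shows "integral torus_box (\<lambda>x. g (x + axis j t)) = integral torus_box g"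
proof -
  let ?b = "(\<chi> i. 2 * pi) :: real^3"
  let ?bt = "(\<chi> i. if i = j then t else 2 * pi) :: real^3"
  have int: "g integrable_on cbox a b" for a b
    by (rule integrable_continuous) (rule continuous_on_subset[OF c], simp)
  have jB: "axis j (1::real) \<in> Basis" by simp
  have box: "cbox a b \<inter> {x. x \<bullet> axis j 1 \<le> d} = cbox a (\<chi> i. if i = j then min (b$j) d else b$i)"
    "cbox a b \<inter> {x. x \<bullet> axis j 1 \<ge> d} = cbox (\<chi> i. if i = j then max (a$j) d else a$i) b"
    for a b :: "real^3" and d
    using interval_split_cart[where a = a and b = b and k = j and c = d]
    by (simp_all only: inner_axis inner_real_def mult_1_right interval_cbox_cart)
  have "integral torus_box (\<lambda>x. g (x + axis j t)) = integral (cbox (axis j t) (?b + axis j t)) g"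
    using integral_shift_cbox_plus[where a = 0 and c = "axis j t" and b = ?b and f = g]
    by (simp add: o_def add.commute[of "axis j t"])
  also have "\<dots> = integral (cbox (axis j t) ?b) g
      + integral (cbox (axis j (2*pi)) (?bt + axis j (2*pi))) g"
  proof -
    have "(\<chi> i. if i = j then min ((?b + axis j t) $ j) (2*pi) else (?b + axis j t) $ i) = ?b"
      "(\<chi> i. if i = j then max (axis j t $ j) (2*pi) else axis j t $ i) = axis j (2*pi)"
      "?b + axis j t = ?bt + axis j (2*pi)"
      using t by (auto simp: vec_eq_iff axis_def)
    then show ?thesis
      using integral_split[OF int jB, of "axis j t" "?b + axis j t" "2*pi"] unfolding box by simp
  qed
  \<comment> \<open>The protruding slab, moved back by one period, is the slab of width t that the
    translation left uncovered.\<close>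
  also have "integral (cbox (axis j (2*pi)) (?bt + axis j (2*pi))) g = integral (cbox 0 ?bt) g"
    using integral_shift_cbox_plus[where a = 0 and c = "axis j (2*pi)" and b = ?bt and f = g]
    by (simp add: o_def add.commute[of "axis j (2*pi)" "_ :: real^3"] p)
  also have "integral (cbox (axis j t) ?b) g + integral (cbox 0 ?bt) g = integral torus_box g"
  proof -
    have "(\<chi> i. if i = j then min (?b $ j) t else ?b $ i) = ?bt"
      "(\<chi> i. if i = j then max ((0::real^3) $ j) t else (0::real^3) $ i) = axis j t"
      using t by (auto simp: vec_eq_iff axis_def)
    then show ?thesis
      using integral_split[OF int jB, of 0 ?b t] unfolding box by (simp add: add.commute)
  qed
  finally show ?thesis .
qed

text \<open>The integral of \<open>g\<close> over the torus does not change under translation along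
  axis j, and its derivative with respect to the translation is the integral of
  \<open>pd j g\<close>. This replaces an iterated integral by a single differentiation under the
  integral sign.\<close>

lemma integral_torus_pd:
  fixes g :: "real^3 \<Rightarrow> 'a::euclidean_space"
  assumes d: "\<And>x. g differentiable (at x)"
    and c: "continuous_on UNIV (pd j g)"
    and p: "\<And>x. g (x + axis j (2 * pi)) = g x"
  shows "integral torus_box (pd j g) = 0"
proof -
  have cg: "continuous_on UNIV g"
    using d by (meson continuous_at_imp_continuous_on differentiable_imp_continuous_within)
  have ax: "axis j t = t *\<^sub>R axis j (1::real)" for t :: real
    by (simp add: vec_eq_iff axis_def)
  have "((\<lambda>t. integral torus_box (\<lambda>x. g (x + t *\<^sub>R axis j 1))) has_vector_derivative
      integral torus_box (\<lambda>x. pd j g (x + 0 *\<^sub>R axis j 1))) (at 0 within {0..1})"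
  proof (rule leibniz_rule_vector_derivative[where fx = "\<lambda>t x. pd j g (x + t *\<^sub>R axis j 1)"])
    show "((\<lambda>t. g (x + t *\<^sub>R axis j 1)) has_vector_derivative pd j g (x + t *\<^sub>R axis j 1))
        (at t within {0..1})" for x t
      by (rule has_vector_derivative_line_pd[OF d])
    show "(\<lambda>x. g (x + t *\<^sub>R axis j 1)) integrable_on torus_box" for t
      by (intro integrable_continuous continuous_on_compose2[OF cg] continuous_intros) auto
    show "continuous_on ({0..1} \<times> torus_box) (\<lambda>(t, x). pd j g (x + t *\<^sub>R axis j 1))"
      unfolding split_beta by (intro continuous_on_compose2[OF c] continuous_intros) auto
  qed auto
  moreover have "((\<lambda>t. integral torus_box (\<lambda>x. g (x + t *\<^sub>R axis j 1))) has_vector_derivative 0)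
      (at 0 within {0..1})"
  proof (rule has_vector_derivative_transform[OF _ _ has_vector_derivative_const])
    \<comment> \<open>Translation invariance is available within one period, and the unit interval
      is short enough because 1 \<le> 2 \<pi>.\<close>
    show "integral torus_box (\<lambda>x. g (x + t *\<^sub>R axis j 1)) = integral torus_box g" if "t \<in> {0..1}" for t
      unfolding ax[symmetric]
      using that pi_gt3 by (intro integral_torus_translate[OF cg p]) auto
  qed auto
  ultimately have "integral torus_box (\<lambda>x. pd j g (x + 0 *\<^sub>R axis j 1)) = 0"
    by (intro vector_derivative_unique_within_closed_interval[of 0 1 0]) (auto simp: cbox_interval)
  then show ?thesis by simp
qed

section \<open>Averages of continuous functions\<close>

lemma continuous_integrable_torus:
  fixes u :: "real^3 \<Rightarrow> 'a::euclidean_space"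
  shows "continuous_on UNIV u \<Longrightarrow> u integrable_on torus_box"
  by (meson continuous_on_subset integrable_continuous subset_UNIV)

lemma content_torus: "measure lborel torus_box = (2 * pi) ^ 3"
  by (subst content_cbox_cart) (auto simp: interval_eq_empty_cart not_less)

lemma avg_const [simp]: "avg (\<lambda>x. c) = c"
  by (simp add: avg_def content_torus)

lemma avg_linear:
  assumes "bounded_linear h" "continuous_on UNIV u"
  shows "avg (\<lambda>x. h (u x)) = h (avg u)"
  using integral_linear[OF continuous_integrable_torus[OF assms(2)] assms(1)]
  by (simp add: avg_def o_def linear_scale[OF bounded_linear.linear[OF assms(1)]])

lemma avg_add:
  assumes "continuous_on UNIV u" "continuous_on UNIV w"
  shows "avg (\<lambda>x. u x + w x) = avg u + avg w"
  using assms[THEN continuous_integrable_torus] by (simp add: avg_def integral_add scaleR_add_right)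

lemma avg_sum:
  assumes "finite I" "\<And>i. i \<in> I \<Longrightarrow> continuous_on UNIV (u i)"
  shows "avg (\<lambda>x. \<Sum>i\<in>I. u i x) = (\<Sum>i\<in>I. avg (u i))"
  unfolding avg_def scaleR_sum_right[symmetric]
  using assms by (subst integral_sum) (auto intro: continuous_integrable_torus)

subsection \<open>Injectivity of the curl\<close>

text \<open>The energy argument below only sees the closed box; periodicity carries its conclusion
  to the whole space.\<close>

lemma periodic_eq_on_torus_box:
  assumes "periodic u" "\<And>x. x \<in> torus_box \<Longrightarrow> u x = c"
  shows "u x = c"
proof -
  have shift_nat: "u (x + axis j (2 * pi * real n)) = u x" for x j n
  proof (induction n)
    case (Suc n)
    have "axis j (2 * pi * real (Suc n)) = axis j (2 * pi * real n) + axis j (2 * pi)"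
      by (simp add: vec_eq_iff axis_def algebra_simps)
    then show ?case
      using assms(1) Suc unfolding periodic_def by (metis add.assoc)
  qed (simp add: axis_def zero_vec_def[symmetric])
  have shift: "u (x + axis j (2 * pi * of_int n)) = u x" for x j n
  proof (cases n)
    case (neg k)
    have "u (x + axis j (2 * pi * of_int n) + axis j (2 * pi * real (Suc k)))
        = u (x + axis j (2 * pi * of_int n))"
      by (rule shift_nat)
    moreover have "real_of_int n = - real (Suc k)"
      using neg by simp
    then have "axis j (2 * pi * of_int n) + axis j (2 * pi * real (Suc k)) = 0"
      by (simp add: vec_eq_iff axis_def del: of_nat_Suc)
    ultimately show ?thesis by (simp add: add.assoc)
  qed (use shift_nat[of x j "nat n"] in auto)
  \<comment> \<open>The number of periods to add in each coordinate so that the shifted point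
    \<open>y\<close> lies in the torus box.\<close>
  define n where "n j = - \<lfloor>x $ j / (2 * pi)\<rfloor>" for j
  define y where "y = x + axis 1 (2 * pi * of_int (n 1)) + axis 2 (2 * pi * of_int (n 2))
      + axis 3 (2 * pi * of_int (n 3))"
  have y: "y $ j = x $ j + 2 * pi * of_int (n j)" for j
    using exhaust_3[of j] by (auto simp: y_def axis_def)
  have "0 \<le> y $ j \<and> y $ j \<le> 2 * pi" for j
    using floor_divide_lower[of "2 * pi" "x $ j"] floor_divide_upper[of "2 * pi" "x $ j"]
    by (simp add: y n_def algebra_simps)
  then have "u y = c"
    by (intro assms(2)) (simp add: mem_box_cart)
  then show ?thesis by (simp add: y_def shift)
qed

text \<open>Vanishing curl means that the matrix of first derivatives is symmetric. With commuting
  second derivatives, component i of the Laplacian then becomes the i-th derivative of the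
  divergence.\<close>

lemma laplacian_eq_0_if_curl_eq_0:
  assumes u: "u \<in> incompressible" and curl: "\<And>x. curl u x = 0"
  shows "(\<Sum>j\<in>UNIV. pd j (pd j u) x) = 0"
proof -
  note Ck = incompressibleD(1)[OF u]
  note d1 = incompressibleD(4)[OF u]
  have d2: "pd j u differentiable (at x)" for j x
    by (rule smooth_differentiable) (rule smooth_pd[OF Ck])
  have c2: "continuous_on UNIV (pd i (pd j u))" for i j
    by (rule Ck_continuous[of 0]) (rule smooth_pd, rule smooth_pd[OF Ck])
  have sym: "pd j u y $ i = pd i u y $ j" for i j y
    using curl[of y] exhaust_3[of i] exhaust_3[of j]
    by (auto simp: curl_def vec_eq_iff forall_3)
  note comp = pd_bounded_linear[OF bounded_linear_vec_nth]
  have "(\<Sum>j\<in>UNIV. pd j (pd j u) x $ i) = 0" for i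
  proof -
    have "pd j (pd j u) x $ i = pd i (pd j u) x $ j" for j
    proof -
      have "pd j (pd j u) x $ i = pd j (\<lambda>y. pd i u y $ j) x"
        by (simp add: comp[OF d2, symmetric] sym[of j _ i])
      also have "\<dots> = pd i (pd j u) x $ j"
        by (simp add: comp[OF d2] pd_commute[OF d1 d2 d2 c2])
      finally show ?thesis .
    qed
    then have "(\<Sum>j\<in>UNIV. pd j (pd j u) x $ i) = (\<Sum>j\<in>UNIV. pd i (\<lambda>y. pd j u y $ j) x)"
      by (simp add: comp[OF d2])
    also have "\<dots> = pd i (divergence u) x"
      unfolding divergence_def[abs_def]
      by (rule pd_sum[symmetric])
        (use d2 bounded_linear.has_derivative[OF bounded_linear_vec_nth] in
          \<open>unfold differentiable_def, blast\<close>)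
    also have "divergence u = (\<lambda>x. 0)"
      using incompressibleD(3)[OF u] by blast
    finally show ?thesis by simp
  qed
  then show ?thesis by (simp add: vec_eq_iff)
qed

text \<open>
  Integrating by parts, the vanishing Laplacian makes the Dirichlet energy of the field vanish.
\<close>
lemma curl_eq_0_imp_eq_0:
  assumes u: "u \<in> incompressible" and avg: "avg u = 0" and curl: "\<And>x. curl u x = 0"
  shows "u = (\<lambda>x. 0)"
proof -
  note Ck = incompressibleD(1)[OF u]
  note per = incompressibleD(2)[OF u]
  note d1 = incompressibleD(4)[OF u]
  have c1: "continuous_on UNIV (pd j u)" for j
    by (rule Ck_continuous[of 0]) (rule smooth_pd[OF Ck])
  have d2: "pd j u differentiable (at x)" for j x
    by (rule smooth_differentiable) (rule smooth_pd[OF Ck])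
  have c2: "continuous_on UNIV (pd i (pd j u))" for i j
    by (rule Ck_continuous[of 0]) (rule smooth_pd, rule smooth_pd[OF Ck])
  \<comment> \<open>The product is the real inner product of \<open>complex^3\<close>, so
    \<open>?E\<close> is a sum of squared norms; the complex bilinear \<open>cdot\<close> would not
    be definite.\<close>
  let ?E = "\<lambda>x. \<Sum>j\<in>UNIV. pd j u x \<bullet> pd j u x"
  let ?g = "\<lambda>j x. u x \<bullet> pd j u x"
  have pdg: "pd j (?g j) = (\<lambda>x. u x \<bullet> pd j (pd j u) x + pd j u x \<bullet> pd j u x)" for j
    by (rule ext) (rule pd_inner[OF d1 d2])
  have cg: "continuous_on UNIV (pd j (?g j))" for j
    unfolding pdg by (intro continuous_intros c1 c2 incompressibleD(5)[OF u])
  have "integral torus_box (pd j (?g j)) = 0" for j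
  proof (rule integral_torus_pd[OF _ cg])
    show "?g j differentiable (at x)" for x
      using has_derivative_inner[OF has_derivative_frechet[OF d1] has_derivative_frechet[OF d2]]
      unfolding differentiable_def by blast
    show "?g j (x + axis j (2 * pi)) = ?g j x" for x
      by (simp add: per pd_periodic[OF d1 per])
  qed
  then have "integral torus_box (\<lambda>x. \<Sum>j\<in>UNIV. pd j (?g j) x) = 0"
    by (subst integral_sum) (auto intro: continuous_integrable_torus cg)
  moreover have "(\<Sum>j\<in>UNIV. pd j (?g j) x) = ?E x" for x
    by (simp add: pdg sum.distrib laplacian_eq_0_if_curl_eq_0[OF u curl]
        flip: inner_sum_right)
  ultimately have intE: "integral torus_box ?E = 0" by simp
  have cE: "continuous_on UNIV ?E"
    by (intro continuous_intros c1)
  have int: "(?E has_integral 0) torus_box"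
    using integrable_integral[OF continuous_integrable_torus[OF cE]] unfolding intE .
  have E0: "?E x = 0" if "x \<in> torus_box" for x
  proof (rule has_integral_0_cbox_imp_0[OF _ _ int _ that])
    show "continuous_on torus_box ?E" by (rule continuous_on_subset[OF cE]) simp
    show "box 0 (\<chi> i. 2 * pi) \<noteq> ({} :: (real^3) set)"
      by (simp add: interval_eq_empty_cart not_le)
  qed (simp add: sum_nonneg)
  have "\<exists>c. \<forall>x\<in>torus_box. u x = c"
  proof (rule has_derivative_zero_constant)
    fix x :: "real^3" assume x: "x \<in> torus_box"
    let ?D = "frechet_derivative u (at x)"
    have D: "(u has_derivative ?D) (at x)" by (rule has_derivative_frechet[OF d1])
    have "pd j u x = 0" for j
      using E0[OF x] by (simp add: sum_nonneg_eq_0_iff)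
    then have D0: "?D (axis j 1) = 0" for j by (simp add: pd_def)
    have "?D h = 0" for h
    proof -
      have "h = (\<Sum>j\<in>UNIV. h $ j *\<^sub>R axis j 1)"
        by (simp add: vec_eq_iff axis_def if_distrib cong: if_cong)
      then have "?D h = ?D (\<Sum>j\<in>UNIV. h $ j *\<^sub>R axis j 1)" by simp
      also have "\<dots> = (\<Sum>j\<in>UNIV. h $ j *\<^sub>R ?D (axis j 1))"
        using has_derivative_linear[OF D] by (simp only: linear_sum linear_scale)
      finally show ?thesis by (simp add: D0)
    qed
    then have "?D = (\<lambda>h. 0)" by blast
    with D show "(u has_derivative (\<lambda>h. 0)) (at x within torus_box)"
      by (metis has_derivative_at_withinI)
  qed auto
  then obtain c where "\<And>x. x \<in> torus_box \<Longrightarrow> u x = c" by blast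
  then have "u x = c" for x
    using periodic_eq_on_torus_box u unfolding incompressible_def by blast
  then have "u = (\<lambda>x. c)" by blast
  with avg show ?thesis by simp
qed

section \<open>Evaluation of the inverse curl\<close>

lemma curl_diff:
  assumes "u differentiable (at x)" "w differentiable (at x)"
  shows "curl (\<lambda>y. u y - w y) x = curl u x - curl w x"
  by (simp add: curl_def pd_diff assms vec_eq_iff forall_3)

text \<open>Two candidates differ by an incompressible field with zero curl and zero average, which
  vanishes. So any exhibited preimage is the one that \<open>inv_into\<close> chooses.\<close>

lemma curl_inv_eqI:
  assumes v: "v \<in> incompressible" "avg v = 0" "curl v = u"
  shows "curl_inv u = v"
proof -
  have "inj_on curl {v \<in> incompressible. avg v = 0}"
  proof (rule inj_onI, clarify)
    fix v w assume v: "v \<in> incompressible" "avg v = 0" and w: "w \<in> incompressible" "avg w = 0"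
      and eq: "curl v = curl w"
    have m: "(\<lambda>x. -1 *s w x) \<in> incompressible" by (rule incompressible_scale[OF w(1)])
    have "avg (\<lambda>x. -1 *s w x) = -1 *s avg w"
      by (rule avg_linear[OF bounded_linear_vector_smult incompressibleD(5)[OF w(1)]])
    moreover have e: "(\<lambda>x. v x + -1 *s w x) = (\<lambda>x. v x - w x)"
      by (simp add: vec_eq_iff fun_eq_iff)
    ultimately have "(\<lambda>x. v x - w x) = (\<lambda>x. 0)"
      using incompressible_add[OF v(1) m] avg_add[OF incompressibleD(5)[OF v(1)] incompressibleD(5)[OF m]] v(2) w(2)
      by (intro curl_eq_0_imp_eq_0)
        (auto simp: curl_diff[OF incompressibleD(4)[OF v(1)] incompressibleD(4)[OF w(1)]] eq)
    then show "v = w" by (simp add: fun_eq_iff)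
  qed
  then show ?thesis
    unfolding curl_inv_def using v by (intro inv_into_f_eq) auto
qed

section \<open>Invariant inner products and dual bases\<close>

lemma lincomb_eq_sum:
  assumes "module s" "finite F" "F \<subseteq> I" "\<And>c. c \<in> I \<Longrightarrow> f c \<noteq> 0 \<Longrightarrow> c \<in> F"
  shows "lincomb s I f X = (\<Sum>c\<in>F. s (f c) (X c))"
  unfolding lincomb_def using assms by (intro sum.mono_neutral_left) (auto simp: module.scale_zero_left)

lemma isum_eq_sum:
  assumes "finite F" "F \<subseteq> I" "\<And>c. c \<in> I \<Longrightarrow> f c \<noteq> 0 \<Longrightarrow> c \<in> F"
  shows "isum I f = sum f F"
  unfolding isum_def using assms by (intro sum.mono_neutral_left) auto

lemma isum_cong: "(\<And>c. c \<in> I \<Longrightarrow> f c = g c) \<Longrightarrow> isum I f = isum I g"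
  unfolding isum_def by (rule sum.cong) auto

lemma isum_minus: "isum I (\<lambda>c. - f c) = - isum I f"
  unfolding isum_def by (simp add: sum_negf)

lemma isum_0: "isum I (\<lambda>c. 0) = 0"
  unfolding isum_def by simp

lemma lincomb_cong: "(\<And>c. c \<in> I \<Longrightarrow> f c = g c) \<Longrightarrow> lincomb s I f X = lincomb s I g X"
  unfolding lincomb_def by (rule sum.cong) auto

lemma lincomb_minus: "module s \<Longrightarrow> lincomb s I (\<lambda>c. - f c) X = - lincomb s I f X"
  unfolding lincomb_def by (simp add: sum_negf module.scale_minus_left)

lemma bilinear_onD:
  assumes "bilinear_on s t V f" "x \<in> V" "y \<in> V" "z \<in> V"
  shows "f (x + y) z = f x z + f y z" "f z (x + y) = f z x + f z y"
    "f (s c x) y = t c (f x y)" "f x (s c y) = t c (f x y)"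
  using assms unfolding bilinear_on_def by auto

lemma bilinear_on_zero:
  assumes "bilinear_on s t V f" "x \<in> V" "0 \<in> V"
  shows "f 0 x = 0" "f x 0 = 0"
  using bilinear_onD(1,2)[OF assms(1,3,3,2)] by simp_all

text \<open>Pairing with \<open>g i\<close> annihilates the span of all other \<open>f j\<close> but
  not \<open>f i\<close>. The diagonal values need only be nonzero, so the Fourier elements can be
  used without normalisation.\<close>

lemma independent_if_bilinear_dual:
  assumes vs: "vector_space s" and bil: "bilinear_on s (*) V ip" and V: "module.subspace s V"
    and f: "f ` J \<subseteq> V" and g: "g ` J \<subseteq> V"
    and diag: "\<And>i. i \<in> J \<Longrightarrow> ip (f i) (g i) \<noteq> 0"
    and off: "\<And>i j. i \<in> J \<Longrightarrow> j \<in> J \<Longrightarrow> i \<noteq> j \<Longrightarrow> ip (f i) (g j) = 0"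
  shows "inj_on f J" "\<not> module.dependent s (f ` J)"
proof -
  interpret vector_space s by (rule vs)
  show inj: "inj_on f J"
    using diag off by (metis inj_onI)
  show "independent (f ` J)"
    unfolding dependent_def
  proof
    assume "\<exists>a\<in>f ` J. a \<in> span (f ` J - {a})"
    then obtain i where i: "i \<in> J" "f i \<in> span (f ` J - {f i})" by blast
    have gi: "g i \<in> V" using g i(1) by blast
    have "x \<in> V \<and> ip x (g i) = 0" if "x \<in> span (f ` J - {f i})" for x
      using that
    proof (induction rule: span_induct_alt)
      case base
      then show ?case using bilinear_on_zero[OF bil gi] subspace_0[OF V] by simp
    next
      case (step c x y)
      then obtain k where "k \<in> J" "x = f k" "k \<noteq> i" by blast
      then have "x \<in> V" "ip x (g i) = 0" using f off i(1) by auto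
      then show ?case
        using step(2) bilinear_onD(1,3)[OF bil _ _ gi] bilinear_onD(3)[OF bil _ gi gi] subspace_scale[OF V] subspace_add[OF V]
        by simp
    qed
    with i diag show False by blast
  qed
qed

text \<open>Joint spanning together with the duality relations determines every coefficient: the one
  at \<open>X a\<close> is the pairing with \<open>Y a\<close>, and conversely. Independence,
  nondegeneracy and directness of the splitting become consequences.\<close>

locale dual_bases = vector_space s for s :: "complex \<Rightarrow> 'v \<Rightarrow> 'v::ab_group_add" +
  fixes V :: "'v set" and br :: "'v \<Rightarrow> 'v \<Rightarrow> 'v" and ip :: "'v \<Rightarrow> 'v \<Rightarrow> complex"
    and I :: "'i set" and X Y :: "'i \<Rightarrow> 'v"
  assumes lie: "lie_algebra_on s V br"
    and bil: "bilinear_on s (*) V ip"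
    and ip_sym: "\<And>x y. x \<in> V \<Longrightarrow> y \<in> V \<Longrightarrow> ip x y = ip y x"
    and ip_inv: "\<And>x y z. x \<in> V \<Longrightarrow> y \<in> V \<Longrightarrow> z \<in> V \<Longrightarrow> ip (br x y) z = ip x (br y z)"
    and XV: "\<And>a. a \<in> I \<Longrightarrow> X a \<in> V" and YV: "\<And>a. a \<in> I \<Longrightarrow> Y a \<in> V"
    and ip_XX: "\<And>a b. a \<in> I \<Longrightarrow> b \<in> I \<Longrightarrow> ip (X a) (X b) = 0"
    and ip_YY: "\<And>a b. a \<in> I \<Longrightarrow> b \<in> I \<Longrightarrow> ip (Y a) (Y b) = 0"
    and ip_XY: "\<And>a b. a \<in> I \<Longrightarrow> b \<in> I \<Longrightarrow> ip (X a) (Y b) = (if a = b then 1 else 0)"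
    and span_XY: "span (X ` I \<union> Y ` I) = V"
begin

lemma ip_YX: "a \<in> I \<Longrightarrow> b \<in> I \<Longrightarrow> ip (Y a) (X b) = (if a = b then 1 else 0)"
  using ip_sym[OF YV XV] ip_XY[of b a] by auto

text \<open>The two families play symmetric roles, so each result about \<open>X\<close> is
  available for \<open>Y\<close>.\<close>

lemma swap: "dual_bases s V br ip I Y X"
  by unfold_locales
    (use lie bil ip_sym ip_inv XV YV ip_XX ip_YY ip_YX span_XY in \<open>simp_all add: Un_commute\<close>)

lemma subV: "subspace V"
  and brV: "x \<in> V \<Longrightarrow> y \<in> V \<Longrightarrow> br x y \<in> V"
  and br_bil: "bilinear_on s s V br"
  and br_self: "x \<in> V \<Longrightarrow> br x x = 0"
  and jacobi: "x \<in> V \<Longrightarrow> y \<in> V \<Longrightarrow> z \<in> V \<Longrightarrow> br x (br y z) + br y (br z x) + br z (br x y) = 0"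
  using lie unfolding lie_algebra_on_def by blast+

lemmas V_closed = subspace_0[OF subV] subspace_add[OF subV] subspace_scale[OF subV] subspace_neg[OF subV]
lemmas ip_linear = bilinear_onD[OF bil]
lemmas ip_zero = bilinear_on_zero[OF bil _ V_closed(1)]

lemma br_anti: "x \<in> V \<Longrightarrow> y \<in> V \<Longrightarrow> br x y = - br y x"
  using br_self[of "x + y"] br_self[of x] br_self[of y] bilinear_onD(1,2)[OF br_bil] V_closed(2)
  by (simp add: eq_neg_iff_add_eq_0 add.commute)

lemma ip_minus:
  assumes "x \<in> V" "y \<in> V"
  shows "ip (- x) y = - ip x y" "ip x (- y) = - ip x y"
  using ip_linear(3,4)[OF assms assms(1), of "-1"] by simp_all

lemma ip_sum:
  assumes "\<And>c. c \<in> F \<Longrightarrow> x c \<in> V" "z \<in> V"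
  shows "ip (sum x F) z = (\<Sum>c\<in>F. ip (x c) z)"
  using assms(1)
proof (induction F rule: infinite_finite_induct)
  case (insert c F)
  then show ?case using ip_linear(1)[of "x c" "sum x F" z] assms(2) subspace_sum[OF subV, of F x] by simp
qed (use ip_zero assms(2) in auto)

text \<open>Spanning supplies some finite representation, and pairing it with the dual elements
  identifies its coefficients. In particular the pairings are nonzero only on the finite index set
  of that representation.\<close>

lemma expansion:
  assumes "x \<in> V"
  shows "finite {a \<in> I. ip x (Y a) \<noteq> 0} \<and> finite {a \<in> I. ip x (X a) \<noteq> 0} \<and>
    x = lincomb s I (\<lambda>a. ip x (Y a)) X + lincomb s I (\<lambda>a. ip x (X a)) Y"
proof -
  have "x \<in> span (X ` I \<union> Y ` I)" using assms span_XY by simp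
  then have "\<exists>F f g. finite F \<and> F \<subseteq> I \<and> x = (\<Sum>a\<in>F. s (f a) (X a)) + (\<Sum>a\<in>F. s (g a) (Y a))"
  proof (induction rule: span_induct_alt)
    case base
    then show ?case by (intro exI[of _ "{}"]) simp
  next
    case (step c x y)
    then obtain F f g where F: "finite F" "F \<subseteq> I"
      and y: "y = (\<Sum>a\<in>F. s (f a) (X a)) + (\<Sum>a\<in>F. s (g a) (Y a))" by blast
    obtain b where b: "b \<in> I" "x = X b \<or> x = Y b" using step(1) by blast
    \<comment> \<open>Both families are kept over one common index set, so adding a generator from
      one of them means padding the other with a zero coefficient.\<close>
    have ext: "(\<Sum>a\<in>F. s (h a) (Z a)) = (\<Sum>a\<in>insert b F. s (if a \<in> F then h a else 0) (Z a))"
      for h and Z :: "'i \<Rightarrow> 'v"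
      by (rule sum.mono_neutral_cong_left) (use F in auto)
    have add: "s c (Z b) + (\<Sum>a\<in>insert b F. s (h a) (Z a))
        = (\<Sum>a\<in>insert b F. s ((if a = b then c else 0) + h a) (Z a))" for h and Z :: "'i \<Rightarrow> 'v"
    proof -
      have "(\<Sum>a\<in>insert b F. s (if a = b then c else 0) (Z a))
          = (\<Sum>a\<in>insert b F. if a = b then s c (Z a) else 0)"
        by (rule sum.cong) auto
      also have "\<dots> = s c (Z b)" using F(1) by simp
      finally show ?thesis by (simp only: scale_left_distrib sum.distrib)
    qed
    show ?case
      using b(2)
    proof
      assume "x = X b"
      then have "s c x + y = (\<Sum>a\<in>insert b F. s ((if a = b then c else 0) + (if a \<in> F then f a else 0)) (X a))
          + (\<Sum>a\<in>insert b F. s (if a \<in> F then g a else 0) (Y a))"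
        unfolding y ext[of f] ext[of g] add[symmetric] by (simp only: add.assoc)
      then show ?thesis
        using F b(1) by (intro exI[of _ "insert b F"] exI conjI) auto
    next
      assume "x = Y b"
      then have "s c x + y = (\<Sum>a\<in>insert b F. s (if a \<in> F then f a else 0) (X a))
          + (\<Sum>a\<in>insert b F. s ((if a = b then c else 0) + (if a \<in> F then g a else 0)) (Y a))"
        unfolding y ext[of f] ext[of g] add[symmetric] by (simp only: add.left_commute)
      then show ?thesis
        using F b(1) by (intro exI[of _ "insert b F"] exI conjI) auto
    qed
  qed
  then obtain F f g where F: "finite F" "F \<subseteq> I"
    and x: "x = (\<Sum>a\<in>F. s (f a) (X a)) + (\<Sum>a\<in>F. s (g a) (Y a))" by blast
  have mem: "(\<Sum>a\<in>F. s (f a) (X a)) \<in> V" "(\<Sum>a\<in>F. s (g a) (Y a)) \<in> V"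
    using F by (auto intro!: subspace_sum[OF subV] V_closed XV YV)
  have ip1: "ip (\<Sum>a\<in>F. s (h a) (Z a)) z = (\<Sum>a\<in>F. h a * ip (Z a) z)"
    if "\<And>a. a \<in> I \<Longrightarrow> Z a \<in> V" "z \<in> V" for h Z z
  proof -
    have "ip (\<Sum>a\<in>F. s (h a) (Z a)) z = (\<Sum>a\<in>F. ip (s (h a) (Z a)) z)"
      using F that by (intro ip_sum) (auto intro: V_closed)
    also have "\<dots> = (\<Sum>a\<in>F. h a * ip (Z a) z)"
      using F that by (intro sum.cong ip_linear(3)) auto
    finally show ?thesis .
  qed
  have delta: "(\<Sum>a\<in>F. h a * (if a = b then 1 else 0)) = (if b \<in> F then h b else 0)" for h :: "'i \<Rightarrow> complex" and b
    using F(1) by (simp add: if_distrib cong: if_cong)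
  have cY: "ip x (Y b) = (if b \<in> F then f b else 0)" if b: "b \<in> I" for b
  proof -
    have "ip x (Y b) = (\<Sum>a\<in>F. f a * ip (X a) (Y b)) + (\<Sum>a\<in>F. g a * ip (Y a) (Y b))"
      using b by (simp add: x ip_linear(1)[OF mem YV] ip1 XV YV)
    also have "\<dots> = (\<Sum>a\<in>F. f a * (if a = b then 1 else 0)) + (\<Sum>a\<in>F. 0)"
      using F(2) b ip_XY ip_YY by (intro arg_cong2[where f = "(+)"] sum.cong refl) auto
    finally show ?thesis by (simp add: delta)
  qed
  have cX: "ip x (X b) = (if b \<in> F then g b else 0)" if b: "b \<in> I" for b
  proof -
    have "ip x (X b) = (\<Sum>a\<in>F. f a * ip (X a) (X b)) + (\<Sum>a\<in>F. g a * ip (Y a) (X b))"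
      using b by (simp add: x ip_linear(1)[OF mem XV] ip1 XV YV)
    also have "\<dots> = (\<Sum>a\<in>F. 0) + (\<Sum>a\<in>F. g a * (if a = b then 1 else 0))"
      using F(2) b ip_YX ip_XX by (intro arg_cong2[where f = "(+)"] sum.cong refl) auto
    finally show ?thesis by (simp add: delta)
  qed
  have "lincomb s I (\<lambda>a. ip x (Y a)) X = (\<Sum>a\<in>F. s (ip x (Y a)) (X a))"
    by (rule lincomb_eq_sum[OF module_axioms F]) (use cY in \<open>metis\<close>)
  also have "\<dots> = (\<Sum>a\<in>F. s (f a) (X a))"
    using F(2) cY by (intro sum.cong) auto
  finally have lX: "lincomb s I (\<lambda>a. ip x (Y a)) X = (\<Sum>a\<in>F. s (f a) (X a))" .
  have "lincomb s I (\<lambda>a. ip x (X a)) Y = (\<Sum>a\<in>F. s (ip x (X a)) (Y a))"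
    by (rule lincomb_eq_sum[OF module_axioms F]) (use cX in \<open>metis\<close>)
  also have "\<dots> = (\<Sum>a\<in>F. s (g a) (Y a))"
    using F(2) cX by (intro sum.cong) auto
  finally have lY: "lincomb s I (\<lambda>a. ip x (X a)) Y = (\<Sum>a\<in>F. s (g a) (Y a))" .
  have "{a \<in> I. ip x (Y a) \<noteq> 0} \<subseteq> F" "{a \<in> I. ip x (X a) \<noteq> 0} \<subseteq> F"
    using cX cY by (auto split: if_splits)
  with F(1) show ?thesis
    unfolding lX lY using x by (auto intro: finite_subset)
qed

lemma ip_lincomb:
  assumes "finite {a \<in> I. f a \<noteq> 0}" "\<And>a. a \<in> I \<Longrightarrow> Z a \<in> V" "z \<in> V"
  shows "ip (lincomb s I f Z) z = isum I (\<lambda>a. f a * ip (Z a) z)"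
proof -
  let ?F = "{a \<in> I. f a \<noteq> 0}"
  have "ip (lincomb s I f Z) z = (\<Sum>a\<in>?F. ip (s (f a) (Z a)) z)"
    unfolding lincomb_def using assms by (intro ip_sum) (auto intro: V_closed)
  also have "\<dots> = (\<Sum>a\<in>?F. f a * ip (Z a) z)"
    using assms by (intro sum.cong refl ip_linear(3)) auto
  also have "\<dots> = isum I (\<lambda>a. f a * ip (Z a) z)"
    using assms(1) by (intro isum_eq_sum[symmetric]) auto
  finally show ?thesis .
qed

lemma lincomb_in_span: "lincomb s I f Z \<in> span (Z ` I)"
  unfolding lincomb_def by (auto intro!: span_sum span_scale intro: span_base)

lemma span_X_V: "x \<in> span (X ` I) \<Longrightarrow> x \<in> V"
  using span_mono[of "X ` I" "X ` I \<union> Y ` I"] span_XY by blast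

lemma span_Y_V: "x \<in> span (Y ` I) \<Longrightarrow> x \<in> V"
  using span_mono[of "Y ` I" "X ` I \<union> Y ` I"] span_XY by blast

lemma parseval:
  assumes x: "x \<in> V" and y: "y \<in> V"
  shows "ip x y = isum I (\<lambda>c. ip x (Y c) * ip (X c) y) + isum I (\<lambda>c. ip x (X c) * ip (Y c) y)"
proof -
  note e = expansion[OF x]
  have "ip x y = ip (lincomb s I (\<lambda>a. ip x (Y a)) X + lincomb s I (\<lambda>a. ip x (X a)) Y) y"
    using e by simp
  also have "\<dots> = ip (lincomb s I (\<lambda>a. ip x (Y a)) X) y + ip (lincomb s I (\<lambda>a. ip x (X a)) Y) y"
    by (intro ip_linear(1) span_X_V span_Y_V lincomb_in_span y)
  finally show ?thesis
    using e by (simp add: ip_lincomb XV YV y)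
qed

lemma nondegenerate:
  assumes "x \<in> V" "\<And>y. y \<in> V \<Longrightarrow> ip x y = 0"
  shows "x = 0"
proof -
  have "lincomb s I (\<lambda>a. ip x (Y a)) X = 0" "lincomb s I (\<lambda>a. ip x (X a)) Y = 0"
    using assms(2) XV YV by (auto simp: lincomb_def intro!: sum.neutral)
  with expansion[OF assms(1)] show ?thesis by simp
qed

section \<open>Isotropy, splitting and subalgebras\<close>

lemma ip_span_X:
  assumes "x \<in> span (X ` I)" "y \<in> span (X ` I)"
  shows "ip x y = 0"
proof -
  have 1: "z \<in> V \<and> ip z (X a) = 0" if "z \<in> span (X ` I)" "a \<in> I" for z a
    using that(1)
  proof (induction rule: span_induct_alt)
    case base
    then show ?case using ip_zero XV that V_closed(1) by simp
  next
    case (step c u v)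
    then obtain b where "b \<in> I" "u = X b" by blast
    then show ?case
      using step that ip_XX by (simp add: ip_linear(1) ip_linear(3)[where z = 0] V_closed XV)
  qed
  have "y \<in> V \<and> ip x y = 0"
    using assms(2)
  proof (induction rule: span_induct_alt)
    case base
    then show ?case using ip_zero span_X_V[OF assms(1)] V_closed(1) by simp
  next
    case (step c u v)
    then obtain b where "b \<in> I" "u = X b" by blast
    then show ?case
      using step 1[OF assms(1)] span_X_V[OF assms(1)]
      by (simp add: ip_linear(2) ip_linear(4)[where z = 0] V_closed XV)
  qed
  then show ?thesis by simp
qed

text \<open>By isotropy of both spans, a common element pairs to 0 with every \<open>X a\<close> and
  every \<open>Y a\<close>, so all coefficients in its expansion vanish.\<close>

lemma direct_sum: "direct_sum_of V (span (X ` I)) (span (Y ` I))"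
  unfolding direct_sum_of_def
proof
  show "V = {x + y | x y. x \<in> span (X ` I) \<and> y \<in> span (Y ` I)}"
    unfolding span_XY[symmetric] span_Un by blast
  interpret dual: dual_bases s V br ip I Y X by (rule swap)
  have "x = 0" if x: "x \<in> span (X ` I)" "x \<in> span (Y ` I)" for x
  proof -
    have "ip x (X a) = 0" "ip x (Y a) = 0" if "a \<in> I" for a
      using that ip_span_X[OF x(1) span_base] dual.ip_span_X[OF x(2) span_base] by blast+
    then have "lincomb s I (\<lambda>a. ip x (Y a)) X = 0" "lincomb s I (\<lambda>a. ip x (X a)) Y = 0"
      by (auto simp: lincomb_def intro!: sum.neutral)
    with expansion[OF span_X_V[OF x(1)]] show ?thesis by simp
  qed
  then show "span (X ` I) \<inter> span (Y ` I) = {0}"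
    by (auto simp: span_zero)
qed

lemma subalgebra_X:
  assumes br: "\<And>a b. a \<in> I \<Longrightarrow> b \<in> I \<Longrightarrow> br (X a) (X b) \<in> span (X ` I)"
  shows "lie_subalgebra_on s V br (span (X ` I))"
proof -
  note bl = bilinear_onD[OF br_bil]
  note z = bilinear_on_zero[OF br_bil _ V_closed(1)]
  have 1: "u \<in> V \<and> br u (X a) \<in> span (X ` I)" if "u \<in> span (X ` I)" "a \<in> I" for u a
    using that(1)
  proof (induction rule: span_induct_alt)
    case base
    then show ?case using z(1)[OF XV[OF that(2)]] by (simp add: span_zero V_closed)
  next
    case (step c u v)
    then obtain b where "b \<in> I" "u = X b" by blast
    then show ?case
      using step that br
      by (simp add: bl(1) bl(3)[where z = 0] V_closed XV span_add span_scale)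
  qed
  have "w \<in> V \<and> br u w \<in> span (X ` I)" if "u \<in> span (X ` I)" "w \<in> span (X ` I)" for u w
    using that(2)
  proof (induction rule: span_induct_alt)
    case base
    then show ?case using z(2)[OF span_X_V[OF that(1)]] by (simp add: span_zero V_closed)
  next
    case (step c x v)
    then obtain b where "b \<in> I" "x = X b" by blast
    then show ?case
      using step 1[OF that(1)] span_X_V[OF that(1)]
      by (simp add: bl(2) bl(4)[where z = 0] V_closed XV span_add span_scale)
  qed
  then show ?thesis
    unfolding lie_subalgebra_on_def using span_X_V by (auto simp: subspace_span)
qed

text \<open>A bracket that stays in the span of \<open>X\<close> pairs to 0 with every
  \<open>X c\<close>; hence the \<open>Y\<close> half of its expansion disappears.\<close>

lemma constants_X:
  assumes "a \<in> I" "b \<in> I" and br: "br (X a) (X b) \<in> span (X ` I)"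
  shows "finite {c \<in> I. ip (br (X a) (X b)) (Y c) \<noteq> 0}"
    "br (X a) (X b) = lincomb s I (\<lambda>c. ip (br (X a) (X b)) (Y c)) X"
proof -
  have "ip (br (X a) (X b)) (X c) = 0" if "c \<in> I" for c
    using br that by (auto intro!: ip_span_X intro: span_base)
  then have "lincomb s I (\<lambda>c. ip (br (X a) (X b)) (X c)) Y = 0"
    by (auto simp: lincomb_def intro!: sum.neutral)
  with expansion[OF span_X_V[OF br]]
  show "finite {c \<in> I. ip (br (X a) (X b)) (Y c) \<noteq> 0}"
    "br (X a) (X b) = lincomb s I (\<lambda>c. ip (br (X a) (X b)) (Y c)) X" by auto
qed

end

text \<open>
  The constants are the values \<open>ip (br (X a) (X b)) (Y c)\<close> and \<open>ip (br (Y a) (Y b)) (X c)\<close>, and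
  invariance turns the mixed brackets into the coadjoint actions. Every quadratic expression in
  the constants is the inner product of two brackets, expanded in the dual bases by \<open>parseval\<close>,
  so that the bialgebra identities become instances of the Jacobi identity.
\<close>
locale dual_subalgebras = dual_bases +
  fixes G M :: "'c \<Rightarrow> 'c \<Rightarrow> 'c \<Rightarrow> complex"
  assumes br_XX: "\<And>a b. a \<in> I \<Longrightarrow> b \<in> I \<Longrightarrow> br (X a) (X b) \<in> span (X ` I)"
    and br_YY: "\<And>a b. a \<in> I \<Longrightarrow> b \<in> I \<Longrightarrow> br (Y a) (Y b) \<in> span (Y ` I)"
    and G: "\<And>a b c. a \<in> I \<Longrightarrow> b \<in> I \<Longrightarrow> c \<in> I \<Longrightarrow> ip (br (X a) (X b)) (Y c) = G a b c"
    and M: "\<And>a b c. a \<in> I \<Longrightarrow> b \<in> I \<Longrightarrow> c \<in> I \<Longrightarrow> ip (br (Y a) (Y b)) (X c) = M a b c"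
begin

lemma swap_subalgebras: "dual_subalgebras s V br ip I Y X M G"
  using swap br_XX br_YY G M
  by (simp add: dual_subalgebras_def dual_subalgebras_axioms_def)

lemma manin: "manin_triple s V br ip (span (X ` I)) (span (Y ` I))"
proof -
  interpret dual: dual_subalgebras s V br ip I Y X M G by (rule swap_subalgebras)
  have "invariant_inner_product_on s V br ip"
    unfolding invariant_inner_product_on_def using bil ip_sym ip_inv nondegenerate by blast
  then show ?thesis
    unfolding manin_triple_def isotropic_def
    using lie direct_sum subalgebra_X[OF br_XX] dual.subalgebra_X[OF br_YY] ip_span_X dual.ip_span_X
    by blast
qed

lemma bracket_XX:
  assumes "a \<in> I" "b \<in> I"
  shows "finite {c \<in> I. G a b c \<noteq> 0}" "br (X a) (X b) = lincomb s I (G a b) X"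
proof -
  have "{c \<in> I. ip (br (X a) (X b)) (Y c) \<noteq> 0} = {c \<in> I. G a b c \<noteq> 0}"
    using G[OF assms] by auto
  with constants_X(1)[OF assms br_XX[OF assms]]
  show "finite {c \<in> I. G a b c \<noteq> 0}" by simp
  show "br (X a) (X b) = lincomb s I (G a b) X"
    using constants_X(2)[OF assms br_XX[OF assms]] by (simp add: G[OF assms] cong: lincomb_cong)
qed

text \<open>Invariance moves \<open>Y b\<close> to the other argument, where it meets
  \<open>Y d\<close> in a bracket inside the second family.\<close>

lemma ip_mixed_Y:
  assumes "a \<in> I" "b \<in> I" "d \<in> I"
  shows "ip (br (X a) (Y b)) (Y d) = M b d a"
proof -
  have "ip (br (X a) (Y b)) (Y d) = ip (X a) (br (Y b) (Y d))"
    using assms by (simp add: ip_inv XV YV)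
  also have "\<dots> = ip (br (Y b) (Y d)) (X a)"
    using assms by (intro ip_sym XV YV brV)
  finally show ?thesis using assms by (simp add: M)
qed

text \<open>Here \<open>Y b\<close> has to be brought to the outer position before invariance lets
  the two \<open>X\<close> meet; that exchange is the source of the minus sign of the coadjoint
  term.\<close>

lemma ip_mixed_X:
  assumes "a \<in> I" "b \<in> I" "d \<in> I"
  shows "ip (br (X a) (Y b)) (X d) = - G a d b"
proof -
  have "ip (br (X a) (Y b)) (X d) = - ip (br (Y b) (X a)) (X d)"
    using assms br_anti[of "X a" "Y b"] by (simp add: ip_minus brV XV YV)
  also have "ip (br (Y b) (X a)) (X d) = ip (Y b) (br (X a) (X d))"
    using assms by (intro ip_inv XV YV)
  also have "\<dots> = ip (br (X a) (X d)) (Y b)"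
    using assms by (intro ip_sym XV YV brV)
  finally show ?thesis using assms by (simp add: G)
qed

text \<open>The mixed pairings are the coefficients of the expansion. Finiteness in these other
  index positions is therefore the finiteness of the expansion of a mixed bracket, with no
  inspection of the constants.\<close>

lemma bracket_XY:
  assumes "a \<in> I" "b \<in> I"
  shows "finite {d \<in> I. G a d b \<noteq> 0}" "finite {d \<in> I. M b d a \<noteq> 0}"
    "br (X a) (Y b) = - lincomb s I (\<lambda>d. G a d b) Y + lincomb s I (\<lambda>d. M b d a) X"
proof -
  note e = expansion[OF brV[OF XV[OF assms(1)] YV[OF assms(2)]]]
  have 1: "{d \<in> I. ip (br (X a) (Y b)) (X d) \<noteq> 0} = {d \<in> I. G a d b \<noteq> 0}"
    "{d \<in> I. ip (br (X a) (Y b)) (Y d) \<noteq> 0} = {d \<in> I. M b d a \<noteq> 0}"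
    using ip_mixed_X[OF assms] ip_mixed_Y[OF assms] by auto
  with e show "finite {d \<in> I. G a d b \<noteq> 0}" "finite {d \<in> I. M b d a \<noteq> 0}" by simp_all
  have "lincomb s I (\<lambda>d. ip (br (X a) (Y b)) (X d)) Y = - lincomb s I (\<lambda>d. G a d b) Y"
    unfolding lincomb_minus[OF module_axioms, symmetric]
    by (rule lincomb_cong) (simp add: ip_mixed_X[OF assms])
  moreover have "lincomb s I (\<lambda>d. ip (br (X a) (Y b)) (Y d)) X = lincomb s I (\<lambda>d. M b d a) X"
    by (rule lincomb_cong) (simp add: ip_mixed_Y[OF assms])
  ultimately show "br (X a) (Y b) = - lincomb s I (\<lambda>d. G a d b) Y + lincomb s I (\<lambda>d. M b d a) X"
    using e by (simp add: add.commute)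
qed

lemma G_anti: "a \<in> I \<Longrightarrow> b \<in> I \<Longrightarrow> c \<in> I \<Longrightarrow> G a b c = - G b a c"
  using G[of a b c] G[of b a c] br_anti[of "X a" "X b"] by (simp add: ip_minus brV XV YV)

text \<open>Each contraction in the Jacobi identity for constants is a coefficient of a double
  bracket, so their cyclic sum is one coefficient of the Jacobi identity.\<close>

lemma lie_constants_G: "lie_constants I G"
proof -
  have step: "isum I (\<lambda>d. G a b d * G d c e) = ip (br (br (X a) (X b)) (X c)) (Y e)"
    if "a \<in> I" "b \<in> I" "c \<in> I" "e \<in> I" for a b c e
  proof -
    note V = that[THEN XV] that[THEN YV]
    have "ip (br (br (X a) (X b)) (X c)) (Y e) = ip (br (X a) (X b)) (br (X c) (Y e))"
      using V by (intro ip_inv brV)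
    also have "\<dots> = isum I (\<lambda>d. ip (br (X a) (X b)) (Y d) * ip (X d) (br (X c) (Y e)))
        + isum I (\<lambda>d. ip (br (X a) (X b)) (X d) * ip (Y d) (br (X c) (Y e)))"
      using V by (intro parseval brV)
    also have "isum I (\<lambda>d. ip (br (X a) (X b)) (X d) * ip (Y d) (br (X c) (Y e))) = isum I (\<lambda>d. 0)"
      using br_XX[OF that(1,2)] by (intro isum_cong) (auto intro!: ip_span_X intro: span_base)
    \<comment> \<open>Invariance pulls \<open>X d\<close> into the bracket with \<open>X c\<close>,
      which turns the second factor into \<open>G d c e\<close>; the other half of
      \<open>parseval\<close> vanished by isotropy.\<close>
    also have "isum I (\<lambda>d. ip (br (X a) (X b)) (Y d) * ip (X d) (br (X c) (Y e)))
        = isum I (\<lambda>d. G a b d * G d c e)"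
      using V that by (intro isum_cong) (simp add: G XV flip: ip_inv)
    finally show ?thesis by (simp add: isum_0)
  qed
  have jac: "ip (br (br (X a) (X b)) (X c)) (Y e) + ip (br (br (X b) (X c)) (X a)) (Y e)
      + ip (br (br (X c) (X a)) (X b)) (Y e) = 0"
    if "a \<in> I" "b \<in> I" "c \<in> I" "e \<in> I" for a b c e
  proof -
    note V = that[THEN XV] that[THEN YV]
    have "br (br (X a) (X b)) (X c) + br (br (X b) (X c)) (X a) + br (br (X c) (X a)) (X b)
        = - (br (X c) (br (X a) (X b)) + br (X a) (br (X b) (X c)) + br (X b) (br (X c) (X a)))"
      using V by (simp add: br_anti[of "br _ _"] brV)
    also have "\<dots> = 0" using jacobi[of "X c" "X a" "X b"] V by simp
    finally have "ip (br (br (X a) (X b)) (X c) + br (br (X b) (X c)) (X a) + br (br (X c) (X a)) (X b)) (Y e) = 0"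
      using ip_zero V by simp
    then show ?thesis using V by (simp add: ip_linear(1) brV V_closed)
  qed
  show ?thesis
    unfolding lie_constants_def
    by (intro conjI ballI) (use bracket_XX(1) G_anti in blast, use G_anti in blast, simp add: step jac)
qed

text \<open>Two of the four terms on the right of the cocycle condition arise from one pairing of
  mixed brackets; exchanging d and e provides the other two.\<close>

lemma ip_mixed_mixed:
  assumes "a \<in> I" "b \<in> I" "d \<in> I" "e \<in> I"
  shows "ip (br (X a) (Y d)) (br (X b) (Y e))
    = isum I (\<lambda>c. G a c d * M c e b) - isum I (\<lambda>c. G b c e * M d c a)"
proof -
  interpret dual: dual_subalgebras s V br ip I Y X M G by (rule swap_subalgebras)
  note V = assms[THEN XV] assms[THEN YV]
  have sym: "ip z (br (X b) (Y e)) = ip (br (X b) (Y e)) z" if "z \<in> V" for z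
    using that V by (intro ip_sym brV)
  have "ip (br (X a) (Y d)) (br (X b) (Y e))
      = isum I (\<lambda>c. ip (br (X a) (Y d)) (Y c) * ip (X c) (br (X b) (Y e)))
        + isum I (\<lambda>c. ip (br (X a) (Y d)) (X c) * ip (Y c) (br (X b) (Y e)))"
    using V by (intro parseval brV)
  also have "isum I (\<lambda>c. ip (br (X a) (Y d)) (Y c) * ip (X c) (br (X b) (Y e)))
      = isum I (\<lambda>c. - (G b c e * M d c a))"
    using assms by (intro isum_cong) (simp add: sym XV ip_mixed_X ip_mixed_Y)
  also have "isum I (\<lambda>c. ip (br (X a) (Y d)) (X c) * ip (Y c) (br (X b) (Y e)))
      = isum I (\<lambda>c. G a c d * M c e b)"
    using assms dual.G_anti[of _ e b] by (intro isum_cong) (simp add: sym YV ip_mixed_X ip_mixed_Y)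
  finally show ?thesis by (simp add: isum_minus)
qed

text \<open>The contraction is the pairing of a bracket in the first family with a bracket in the
  second. Invariance moves \<open>X b\<close> across, and the Jacobi identity distributes it over
  \<open>Y d\<close> and \<open>Y e\<close>.\<close>

lemma ip_bracket_bracket:
  assumes "a \<in> I" "b \<in> I" "d \<in> I" "e \<in> I"
  shows "isum I (\<lambda>c. G a b c * M d e c)
    = ip (br (X a) (Y d)) (br (X b) (Y e)) - ip (br (X a) (Y e)) (br (X b) (Y d))"
proof -
  note V = assms[THEN XV] assms[THEN YV]
  have sym: "ip z (br (Y d) (Y e)) = ip (br (Y d) (Y e)) z" if "z \<in> V" for z
    using that V by (intro ip_sym brV)
  have "ip (br (X a) (X b)) (br (Y d) (Y e))
      = isum I (\<lambda>c. ip (br (X a) (X b)) (Y c) * ip (X c) (br (Y d) (Y e)))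
        + isum I (\<lambda>c. ip (br (X a) (X b)) (X c) * ip (Y c) (br (Y d) (Y e)))"
    using V by (intro parseval brV)
  also have "isum I (\<lambda>c. ip (br (X a) (X b)) (X c) * ip (Y c) (br (Y d) (Y e))) = isum I (\<lambda>c. 0)"
    using br_XX[OF assms(1,2)] by (intro isum_cong) (auto intro!: ip_span_X intro: span_base)
  also have "isum I (\<lambda>c. ip (br (X a) (X b)) (Y c) * ip (X c) (br (Y d) (Y e)))
      = isum I (\<lambda>c. G a b c * M d e c)"
    using assms by (intro isum_cong) (simp add: G M sym XV)
  finally have 1: "isum I (\<lambda>c. G a b c * M d e c) = ip (br (X a) (X b)) (br (Y d) (Y e))"
    by (simp add: isum_0)
  have "ip (br (X a) (X b)) (br (Y d) (Y e)) = ip (X a) (br (X b) (br (Y d) (Y e)))"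
    using V by (intro ip_inv brV)
  also have "br (X b) (br (Y d) (Y e)) = br (Y d) (br (X b) (Y e)) + - br (Y e) (br (X b) (Y d))"
  proof -
    have "br (Y d) (br (Y e) (X b)) = - br (Y d) (br (X b) (Y e))"
      using V bilinear_onD(4)[OF br_bil, of "Y d" "br (X b) (Y e)" _ "-1"]
      by (simp add: br_anti[of "Y e" "X b"] brV)
    with jacobi[of "X b" "Y d" "Y e"] V
    have "br (X b) (br (Y d) (Y e)) - br (Y d) (br (X b) (Y e)) + br (Y e) (br (X b) (Y d)) = 0"
      by simp
    then have "br (X b) (br (Y d) (Y e)) - br (Y d) (br (X b) (Y e)) = - br (Y e) (br (X b) (Y d))"
      by (simp only: eq_neg_iff_add_eq_0)
    then show ?thesis by (simp only: diff_eq_eq add.commute)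
  qed
  also have "ip (X a) \<dots> = ip (X a) (br (Y d) (br (X b) (Y e))) - ip (X a) (br (Y e) (br (X b) (Y d)))"
    using V by (subst ip_linear(2)) (simp_all add: ip_minus brV V_closed)
  also have "\<dots> = ip (br (X a) (Y d)) (br (X b) (Y e)) - ip (br (X a) (Y e)) (br (X b) (Y d))"
    using V by (simp only: ip_inv brV)
  finally show ?thesis unfolding 1 .
qed

text \<open>The cocycle condition equates two evaluations of the pairing of
  \<open>br (X a) (X b)\<close> with \<open>br (Y d) (Y e)\<close>. Antisymmetry of the cobracket
  constants brings the terms with d and e exchanged into the index order of the definition.\<close>

lemma bialgebra: "lie_bialgebra_constants I G M"
proof -
  interpret dual: dual_subalgebras s V br ip I Y X M G by (rule swap_subalgebras)
  have "isum I (\<lambda>c. G a c e * M c d b) = - isum I (\<lambda>c. G a c e * M d c b)"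
    if "b \<in> I" "d \<in> I" for a b d e
    unfolding isum_minus[symmetric] using that dual.G_anti[of _ d b] by (intro isum_cong) simp
  moreover have "isum I (\<lambda>c. G b c d * M e c a) = - isum I (\<lambda>c. G b c d * M c e a)"
    if "a \<in> I" "e \<in> I" for a b d e
    unfolding isum_minus[symmetric] using that dual.G_anti[of e _ a] by (intro isum_cong) simp
  ultimately show ?thesis
    unfolding lie_bialgebra_constants_def
    using lie_constants_G dual.lie_constants_G bracket_XY(1) bracket_XY(2)
      ip_bracket_bracket ip_mixed_mixed
    by simp
qed

end

section \<open>Plane waves\<close>

definition kvec :: "int^3 \<Rightarrow> complex^3" where
  "kvec m = cvec (rvec m)"

lemma kvec_nth [simp]: "kvec m $ j = of_int (m $ j)"
  by (simp add: kvec_def cvec_def rvec_def)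

lemma kvec_simps [simp]: "kvec 0 = 0" "kvec (m + n) = kvec m + kvec n" "kvec (- m) = - kvec m"
  "kvec (m - n) = kvec m - kvec n"
  by (simp_all add: vec_eq_iff)

lemma rvec_simps [simp]: "rvec 0 = 0" "rvec (m + n) = rvec m + rvec n" "rvec (- m) = - rvec m"
  by (simp_all add: rvec_def vec_eq_iff)

section \<open>Algebra of the complex bilinear dot and cross products\<close>

lemma cdot_simps:
  "cdot (u + v) w = cdot u w + cdot v w" "cdot w (u + v) = cdot w u + cdot w v"
  "cdot (u - v) w = cdot u w - cdot v w" "cdot w (u - v) = cdot w u - cdot w v"
  "cdot (- u) w = - cdot u w" "cdot w (- u) = - cdot w u"
  "cdot (c *s u) w = c * cdot u w" "cdot w (c *s u) = c * cdot w u"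
  "cdot 0 w = 0" "cdot w 0 = 0"
  by (simp_all add: cdot_def sum_3 algebra_simps)

lemma ccross_simps:
  "ccross (u + v) w = ccross u w + ccross v w" "ccross w (u + v) = ccross w u + ccross w v"
  "ccross (u - v) w = ccross u w - ccross v w" "ccross w (u - v) = ccross w u - ccross w v"
  "ccross (- u) w = - ccross u w" "ccross w (- u) = - ccross w u"
  "ccross (c *s u) w = c *s ccross u w" "ccross w (c *s u) = c *s ccross w u"
  "ccross 0 w = 0" "ccross w 0 = 0" "ccross w w = 0"
  by (simp_all add: ccross_def vec_eq_iff forall_3 algebra_simps)

lemma cdot_commute: "cdot u w = cdot w u"
  by (simp add: cdot_def mult.commute)

lemma ccross_anti: "ccross u w = - ccross w u"
  by (simp add: ccross_def vec_eq_iff forall_3)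

lemma cdot_ccross_same: "cdot u (ccross u w) = 0" "cdot u (ccross w u) = 0"
  by (simp_all add: cdot_def ccross_def sum_3 algebra_simps)

lemma cdot_ccross_rotate: "cdot u (ccross v w) = cdot v (ccross w u)"
  by (simp add: cdot_def ccross_def sum_3 algebra_simps)

lemma ccross_ccross: "ccross u (ccross v w) = cdot u w *s v - cdot u v *s w"
  by (simp add: cdot_def ccross_def vec_eq_iff forall_3 sum_3 algebra_simps)

lemma cdot_ccross_ccross:
  "cdot (ccross u v) (ccross w z) = cdot u w * cdot v z - cdot u z * cdot v w"
  by (simp add: cdot_def ccross_def sum_3 algebra_simps)

lemma cdot_cvec: "cdot (cvec u) (cvec w) = of_real (u \<bullet> w)"
  by (simp add: cdot_def cvec_def inner_vec_def)

lemma ccross_cvec: "ccross (cvec u) (cvec w) = cvec (cross3 u w)"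
  by (simp add: ccross_def cvec_def cross3_def vec_eq_iff forall_3)

text \<open>A complex bilinear square can vanish on nonzero vectors; frequencies are real, so theirs
  is a squared length and may be divided by.\<close>

lemma cdot_kvec_self_eq_0: "cdot (kvec m) (kvec m) = 0 \<longleftrightarrow> m = 0"
proof -
  have "cdot (kvec m) (kvec m) = of_real (rvec m \<bullet> rvec m)"
    by (simp add: kvec_def cdot_cvec)
  moreover have "rvec m = 0 \<longleftrightarrow> m = 0"
    by (simp add: rvec_def vec_eq_iff)
  ultimately show ?thesis by simp
qed

section \<open>Calculus of a single plane wave\<close>

definition wave :: "int^3 \<Rightarrow> complex^3 \<Rightarrow> field" where
  "wave m p = (\<lambda>x. emode m x *s p)"

lemma emode_0 [simp]: "emode 0 x = 1"
  by (simp add: emode_def)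

lemma emode_add: "emode (m + n) x = emode m x * emode n x"
  by (simp add: emode_def inner_add_left algebra_simps flip: exp_add)

lemma emode_periodic: "emode m (x + axis j (2 * pi)) = emode m x"
proof -
  have "\<i> * complex_of_real (rvec m \<bullet> (x + axis j (2 * pi)))
      = \<i> * complex_of_real (rvec m \<bullet> x) + complex_of_real (2 * of_int (m $ j) * pi) * \<i>"
    by (simp add: inner_add_right inner_axis rvec_def algebra_simps)
  moreover have "exp (complex_of_real (2 * of_int (m $ j) * pi) * \<i>) = 1"
    by (subst exp_eq_1) (auto intro: exI[of _ "m $ j"])
  ultimately show ?thesis by (simp add: emode_def exp_add)
qed

lemma emode_has_derivative:
  "(emode m has_derivative (\<lambda>h. emode m x * (\<i> * of_real (rvec m \<bullet> h)))) (at x)"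
proof -
  have "((\<lambda>x. \<i> * complex_of_real (rvec m \<bullet> x)) has_derivative (\<lambda>h. \<i> * of_real (rvec m \<bullet> h))) (at x)"
    by (auto intro!: derivative_eq_intros has_derivative_of_real)
  from has_derivative_compose[OF this DERIV_exp[unfolded has_field_derivative_def]]
  show ?thesis unfolding emode_def[abs_def] .
qed

lemma pd_emode: "pd j (emode m) x = emode m x * (\<i> * of_int (m $ j))"
  using pd_eqI[OF emode_has_derivative, of j m x] by (simp add: inner_axis rvec_def)

lemma grad_emode: "grad (emode m) x = emode m x *s (\<i> *s kvec m)"
  by (simp add: grad_def pd_emode vec_eq_iff)

lemma wave_has_derivative:
  "(wave m p has_derivative (\<lambda>h. (emode m x * (\<i> * of_real (rvec m \<bullet> h))) *s p)) (at x)"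
  unfolding wave_def
  by (rule bounded_linear.has_derivative[OF
        bounded_bilinear.bounded_linear_left[OF bounded_bilinear_vector_smult] emode_has_derivative])

lemma wave_differentiable: "wave m p differentiable (at x)"
  using wave_has_derivative unfolding differentiable_def by blast

lemma pd_wave: "pd j (wave m p) = wave m ((\<i> * of_int (m $ j)) *s p)"
proof
  show "pd j (wave m p) x = wave m ((\<i> * of_int (m $ j)) *s p) x" for x
    using pd_eqI[OF wave_has_derivative, of j m p x] by (simp add: inner_axis rvec_def wave_def mult.assoc)
qed

lemma continuous_wave: "continuous_on S (wave m p)"
  by (meson continuous_at_imp_continuous_on differentiable_imp_continuous_within wave_differentiable)

lemma Ck_wave: "Ck k (wave m p)"
  by (induction k arbitrary: p)
    (simp_all add: continuous_wave pd_wave differentiable_on_def wave_differentiable)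

lemma wave_linear: "wave m (p + q) = (\<lambda>x. wave m p x + wave m q x)" "wave m (c *s p) = (\<lambda>x. c *s wave m p x)"
  "wave m 0 = (\<lambda>x. 0)"
  by (simp_all add: wave_def vec_eq_iff fun_eq_iff algebra_simps)

text \<open>For a frequency with m $ j \<noteq> 0 the wave is the j-th derivative of the periodic
  wave with amplitude divided by \<i> (m $ j), and derivatives of periodic functions integrate to
  0.\<close>

lemma avg_wave: "avg (wave m p) = (if m = 0 then p else 0)"
proof (cases "m = 0")
  case True
  then show ?thesis by (simp add: wave_def)
next
  case False
  then obtain j where j: "m $ j \<noteq> 0" by (auto simp: vec_eq_iff)
  let ?g = "wave m ((1 / (\<i> * of_int (m $ j))) *s p)"
  have "integral torus_box (pd j ?g) = 0"
    by (rule integral_torus_pd)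
      (auto simp: wave_differentiable pd_wave continuous_wave, simp add: wave_def emode_periodic)
  moreover have "pd j ?g = wave m p"
    using j by (simp add: pd_wave)
  ultimately show ?thesis using False by (simp add: avg_def)
qed

lemma osc_wave: "osc (wave m p) = (if m = 0 then (\<lambda>x. 0) else wave m p)"
  unfolding osc_def by (rule ext) (simp add: avg_wave, simp add: wave_def)

lemma wave_bilinear:
  "ccross (wave m p x) (wave n q x) = wave (m + n) (ccross p q) x"
  "cdot (wave m p x) (wave n q x) = emode (m + n) x * cdot p q"
  by (simp_all add: wave_def ccross_simps cdot_simps emode_add vector_smult_assoc mult_ac)

lemma avg_emode: "avg (\<lambda>x. emode m x * c) = (if m = 0 then c else 0)"
proof -
  have "avg (\<lambda>x. emode m x * c) = avg (\<lambda>x. wave m (axis 1 c) x $ 1)"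
    by (simp add: wave_def)
  also have "\<dots> = avg (wave m (axis 1 c)) $ 1"
    by (rule avg_linear[OF bounded_linear_vec_nth continuous_wave])
  finally show ?thesis by (simp add: avg_wave)
qed

lemma divergence_wave: "divergence (wave m p) x = emode m x * (\<i> * cdot (kvec m) p)"
  unfolding divergence_def pd_wave by (simp add: wave_def cdot_def sum_distrib_left mult_ac)

lemma incompressible_wave: "cdot (kvec m) p = 0 \<Longrightarrow> wave m p \<in> incompressible"
  by (simp add: incompressible_def Ck_wave divergence_wave periodic_def)
    (simp add: wave_def emode_periodic)

lemma curl_wave: "curl (wave m p) = wave m (\<i> *s ccross (kvec m) p)"
  by (rule ext) (simp add: curl_def pd_wave, simp add: wave_def ccross_def vec_eq_iff forall_3 algebra_simps)

lemma convect_wave: "convect (wave m p) (wave n q) x = wave (m + n) ((\<i> * cdot p (kvec n)) *s q) x"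
  by (simp add: convect_def pd_wave)
    (simp add: wave_def vec_eq_iff cdot_def emode_add sum_3 algebra_simps)

section \<open>The Lie algebra of trigonometric polynomials\<close>

text \<open>Every wave carries a central part of its own, so a single family generates the whole
  extension and inductions over generators have one case.\<close>

definition hwave :: "int^3 \<Rightarrow> complex^3 \<Rightarrow> complex^3 \<Rightarrow> hat" where
  "hwave m p c = (wave m p, c)"

lemma hwave_add: "hwave m (p + q) (c + d) = hwave m p c + hwave m q d"
  by (simp add: hwave_def wave_linear fun_eq_iff)

lemma hscale_hwave: "hscale a (hwave m p c) = hwave m (a *s p) (a *s c)"
  by (simp add: hwave_def hscale_def wave_linear)

lemma hwave_0 [simp]: "hwave m 0 0 = 0"
  by (simp add: hwave_def wave_linear zero_prod_def zero_fun_def)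

lemma hwave_zero_amplitude: "hwave m 0 c = hwave n 0 c"
  by (simp add: hwave_def wave_linear)

text \<open>The product of the exponentials has nonzero average only at m + n = 0. The further
  condition m \<noteq> 0 reflects that \<open>cocycle\<close> removes averages first, so constant
  fields contribute nothing.\<close>

lemma hbracket_hwave:
  "hbracket (hwave m p c) (hwave n q d)
    = hwave (m + n) (\<i> *s (cdot p (kvec n) *s q - cdot q (kvec m) *s p))
        (if m + n = 0 \<and> m \<noteq> 0 then ccross q p else 0)"
proof -
  have "vbracket (wave m p) (wave n q) = wave (m + n) (\<i> *s (cdot p (kvec n) *s q - cdot q (kvec m) *s p))"
    by (rule ext) (simp add: vbracket_def convect_wave add.commute[of n m],
        simp add: wave_def vec_eq_iff algebra_simps)
  moreover have "cocycle (wave m p) (wave n q) = (if m + n = 0 \<and> m \<noteq> 0 then ccross q p else 0)"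
  proof (cases "m = 0 \<or> n = 0")
    case True
    then show ?thesis by (auto simp: cocycle_def osc_wave ccross_simps)
  next
    case False
    then have "cocycle (wave m p) (wave n q) = avg (wave (n + m) (ccross q p))"
      by (simp add: cocycle_def osc_wave wave_bilinear)
    then show ?thesis using False by (simp add: avg_wave add.commute)
  qed
  ultimately show ?thesis by (simp add: hbracket_def hwave_def)
qed

text \<open>On vectors orthogonal to the frequency k, crossing twice with k is multiplication by
  minus the squared length of k. Hence the curl symbol, \<i> times the cross product with k, is
  inverted by itself divided by that squared length.\<close>

lemma ccross_kvec_inverse:
  assumes "n \<noteq> 0" "cdot (kvec n) q = 0"
  shows "\<i> *s ccross (kvec n) ((\<i> / cdot (kvec n) (kvec n)) *s ccross (kvec n) q) = q"
  using assms cdot_kvec_self_eq_0[of n]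
  by (simp add: ccross_simps ccross_ccross vec_eq_iff cdot_commute)

lemma curl_inv_wave:
  assumes "n \<noteq> 0" "cdot (kvec n) q = 0"
  shows "curl_inv (wave n q) = wave n ((\<i> / cdot (kvec n) (kvec n)) *s ccross (kvec n) q)"
proof (rule curl_inv_eqI)
  show "wave n ((\<i> / cdot (kvec n) (kvec n)) *s ccross (kvec n) q) \<in> incompressible"
    by (rule incompressible_wave) (simp add: cdot_simps cdot_ccross_same)
  show "curl (wave n ((\<i> / cdot (kvec n) (kvec n)) *s ccross (kvec n) q)) = wave n q"
    by (simp only: curl_wave ccross_kvec_inverse[OF assms])
qed (use assms in \<open>simp add: avg_wave\<close>)

lemma curl_0: "curl (\<lambda>x. 0) = (\<lambda>x. 0)"
  by (simp add: curl_def fun_eq_iff vec_eq_iff forall_3)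

lemma curl_inv_0: "curl_inv (\<lambda>x. 0) = (\<lambda>x. 0)"
proof (rule curl_inv_eqI)
  show "(\<lambda>x. 0) \<in> incompressible"
    using incompressible_wave[of 0 0] by (simp add: wave_linear cdot_simps)
qed (simp_all add: curl_0)

lemma pairing_hwave:
  assumes "cdot (kvec n) q = 0"
  shows "pairing (hwave m p c) (hwave n q d)
    = (if m + n = 0 \<and> n \<noteq> 0 then \<i> / cdot (kvec n) (kvec n) * cdot p (ccross (kvec n) q) else 0)
      + cdot c (if n = 0 then q else 0) + cdot d (if m = 0 then p else 0)"
proof -
  have "avg (\<lambda>x. cdot (osc (wave m p) x) (curl_inv (osc (wave n q)) x))
    = (if m + n = 0 \<and> n \<noteq> 0 then \<i> / cdot (kvec n) (kvec n) * cdot p (ccross (kvec n) q) else 0)"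
  proof (cases "m = 0 \<or> n = 0")
    case True
    then show ?thesis by (auto simp: osc_wave curl_inv_0 cdot_simps)
  next
    case False
    then have "avg (\<lambda>x. cdot (osc (wave m p) x) (curl_inv (osc (wave n q)) x))
        = avg (\<lambda>x. emode (m + n) x * (\<i> / cdot (kvec n) (kvec n) * cdot p (ccross (kvec n) q)))"
      by (simp add: osc_wave curl_inv_wave assms wave_bilinear cdot_simps)
    then show ?thesis using False by (simp only: avg_emode) simp
  qed
  then show ?thesis by (simp add: pairing_def hwave_def avg_wave)
qed

subsection \<open>Generators\<close>

definition solenoidal_waves :: "hat set" where
  "solenoidal_waves = {hwave m p c | m p c. cdot (kvec m) p = 0}"

lemma hatS_trigD:
  assumes "U \<in> hatS_trig"
  shows "fst U \<in> incompressible" "trig_poly (fst U)" "continuous_on UNIV (fst U)"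
    "fst U differentiable (at x)"
  using assms incompressibleD(4,5)[of "fst U"] by (auto simp: hatS_trig_def hatS_def)

lemma trig_polyI: "finite F \<Longrightarrow> trig_poly (\<lambda>x. \<Sum>m\<in>F. wave m (k m) x)"
  unfolding trig_poly_def wave_def by blast

lemma trig_polyE:
  assumes "trig_poly u"
  obtains F k where "finite F" "u = (\<lambda>x. \<Sum>m\<in>F. wave m (k m) x)"
  using assms unfolding trig_poly_def wave_def by blast

lemma trig_poly_wave: "trig_poly (wave m p)"
  using trig_polyI[of "{m}" "\<lambda>m. p"] by simp

lemma trig_poly_add:
  assumes "trig_poly u" "trig_poly w"
  shows "trig_poly (\<lambda>x. u x + w x)"
proof -
  obtain F k where F: "finite F" "u = (\<lambda>x. \<Sum>m\<in>F. wave m (k m) x)"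
    using assms(1) by (rule trig_polyE)
  obtain F' k' where F': "finite F'" "w = (\<lambda>x. \<Sum>m\<in>F'. wave m (k' m) x)"
    using assms(2) by (rule trig_polyE)
  let ?k = "\<lambda>m. (if m \<in> F then k m else 0) + (if m \<in> F' then k' m else 0)"
  have "u x = (\<Sum>m\<in>F \<union> F'. wave m (if m \<in> F then k m else 0) x)" for x
    unfolding F(2) using F(1) F'(1) by (intro sum.mono_neutral_cong_left) (auto simp: wave_linear)
  moreover have "w x = (\<Sum>m\<in>F \<union> F'. wave m (if m \<in> F' then k' m else 0) x)" for x
    unfolding F'(2) using F(1) F'(1) by (intro sum.mono_neutral_cong_left) (auto simp: wave_linear)
  ultimately have "(\<lambda>x. u x + w x) = (\<lambda>x. \<Sum>m\<in>F \<union> F'. wave m (?k m) x)"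
    by (simp add: wave_linear(1) sum.distrib)
  then show ?thesis using trig_polyI[of "F \<union> F'" ?k] F(1) F'(1) by simp
qed

lemma trig_poly_scale:
  assumes "trig_poly u"
  shows "trig_poly (\<lambda>x. c *s u x)"
proof -
  obtain F k where F: "finite F" "u = (\<lambda>x. \<Sum>m\<in>F. wave m (k m) x)"
    using assms by (rule trig_polyE)
  then have "(\<lambda>x. c *s u x) = (\<lambda>x. \<Sum>m\<in>F. wave m (c *s k m) x)"
    by (simp add: wave_linear(2) vec.scale_sum_right)
  then show ?thesis using trig_polyI[OF F(1)] by simp
qed

lemma hwave_in_hatS_trig: "cdot (kvec m) p = 0 \<Longrightarrow> hwave m p c \<in> hatS_trig"
  by (simp add: hatS_trig_def hatS_def hwave_def incompressible_wave trig_poly_wave)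

lemma subspace_hatS_trig: "hat.subspace hatS_trig"
  unfolding hat.subspace_def
proof (intro conjI ballI allI)
  show "0 \<in> hatS_trig"
    using hwave_in_hatS_trig[of 0 0 0] by (simp add: cdot_simps)
  show "U + W \<in> hatS_trig" if "U \<in> hatS_trig" "W \<in> hatS_trig" for U W
    using that incompressible_add trig_poly_add
    by (simp add: hatS_trig_def hatS_def plus_fun_def)
  show "hscale c U \<in> hatS_trig" if "U \<in> hatS_trig" for U c
    using that incompressible_scale trig_poly_scale
    by (simp add: hatS_trig_def hatS_def hscale_def)
qed

text \<open>Multiplying the divergence by the wave of frequency - n and averaging extracts its
  Fourier coefficient at n.\<close>

lemma divergence_trig_poly_eq_0:
  assumes F: "finite F" and div: "\<And>x. divergence (\<lambda>x. \<Sum>m\<in>F. wave m (k m) x) x = 0" and n: "n \<in> F"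
  shows "cdot (kvec n) (k n) = 0"
proof -
  let ?d = "\<lambda>m. \<i> * cdot (kvec m) (k m)"
  have "(\<Sum>m\<in>F. emode m x * ?d m) = 0" for x
  proof -
    have "divergence (\<lambda>x. \<Sum>m\<in>F. wave m (k m) x) x = (\<Sum>j\<in>UNIV. \<Sum>m\<in>F. pd j (wave m (k m)) x $ j)"
      unfolding divergence_def by (simp add: pd_sum wave_differentiable)
    also have "\<dots> = (\<Sum>m\<in>F. divergence (wave m (k m)) x)"
      unfolding divergence_def by (rule sum.swap)
    finally show ?thesis using div by (simp add: divergence_wave)
  qed
  then have "(\<Sum>m\<in>F. emode (m + - n) x * ?d m) = 0" for x
    by (simp add: emode_add mult.assoc mult.left_commute[of _ "emode (- n) x"] flip: sum_distrib_left
        del: uminus_add_conv_diff add_uminus_conv_diff)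
  then have "0 = avg (\<lambda>x. \<Sum>m\<in>F. emode (m + - n) x * ?d m)" by simp
  also have "\<dots> = (\<Sum>m\<in>F. avg (\<lambda>x. emode (m + - n) x * ?d m))"
  proof (rule avg_sum[OF F])
    show "continuous_on UNIV (\<lambda>x. emode (m + - n) x * ?d m)" for m
      unfolding emode_def by (intro continuous_intros)
  qed
  also have "\<dots> = (\<Sum>m\<in>F. if m = n then ?d m else 0)"
    by (simp only: avg_emode) (simp add: eq_neg_iff_add_eq_0[symmetric])
  also have "\<dots> = ?d n" using F n by simp
  finally show ?thesis by simp
qed

text \<open>A divergence-free trigonometric polynomial is divergence-free frequency by frequency, so
  its individual waves already belong to the space.\<close>

lemma hatS_trig_eq_span: "hatS_trig = hat.span solenoidal_waves"
proof
  show "hat.span solenoidal_waves \<subseteq> hatS_trig"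
    by (rule hat.span_minimal[OF _ subspace_hatS_trig])
      (auto simp: solenoidal_waves_def hwave_in_hatS_trig)
  show "hatS_trig \<subseteq> hat.span solenoidal_waves"
  proof
    fix U assume U: "U \<in> hatS_trig"
    obtain F k where F: "finite F" "fst U = (\<lambda>x. \<Sum>m\<in>F. wave m (k m) x)"
      using hatS_trigD(2)[OF U] by (rule trig_polyE)
    have "cdot (kvec m) (k m) = 0" if "m \<in> F" for m
      using incompressibleD(3)[OF hatS_trigD(1)[OF U]] that F(1) unfolding F(2)
      by (intro divergence_trig_poly_eq_0)
    then have "hwave m (k m) 0 \<in> solenoidal_waves" if "m \<in> F" for m
      using that by (auto simp: solenoidal_waves_def)
    moreover have "hwave 0 0 (snd U) \<in> solenoidal_waves"
      unfolding solenoidal_waves_def by (auto intro!: exI simp: cdot_simps)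
    ultimately have "(\<Sum>m\<in>F. hwave m (k m) 0) + hwave 0 0 (snd U) \<in> hat.span solenoidal_waves"
      by (intro hat.span_add hat.span_sum hat.span_base)
    moreover have "(\<Sum>m\<in>G. hwave m (k m) 0) = ((\<lambda>x. \<Sum>m\<in>G. wave m (k m) x), 0)" for G
      by (induction G rule: infinite_finite_induct)
        (simp_all add: hwave_def zero_prod_def zero_fun_def plus_fun_def)
    then have "(\<Sum>m\<in>F. hwave m (k m) 0) + hwave 0 0 (snd U) = U"
      by (simp add: hwave_def wave_linear prod_eq_iff F(2) plus_fun_def)
    ultimately show "U \<in> hat.span solenoidal_waves" by simp
  qed
qed

text \<open>Multilinear identities need only be checked on waves. \<open>scale_add\<close> merges
  additivity and homogeneity into one case, with membership premises because derivatives and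
  averages are linear only on sufficiently regular fields.\<close>

lemma hatS_trig_induct [consumes 1, case_names zero wave scale_add]:
  assumes U: "U \<in> hatS_trig"
    and zero: "P 0"
    and wave: "\<And>m p c. cdot (kvec m) p = 0 \<Longrightarrow> P (hwave m p c)"
    and scale_add: "\<And>a U W. U \<in> hatS_trig \<Longrightarrow> W \<in> hatS_trig \<Longrightarrow> P U \<Longrightarrow> P W \<Longrightarrow> P (hscale a U + W)"
  shows "P U"
proof -
  have "U \<in> hatS_trig \<and> P U"
    using U unfolding hatS_trig_eq_span
  proof (induction rule: hat.span_induct_alt)
    case base
    show ?case using zero by (simp add: hat.span_zero)
  next
    case (step a x y)
    then obtain m p c where "cdot (kvec m) p = 0" "x = hwave m p c"
      by (auto simp: solenoidal_waves_def)
    then have "x \<in> hatS_trig" "P x" by (simp_all add: hwave_in_hatS_trig wave)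
    with step(2) show ?case
      using scale_add subspace_hatS_trig unfolding hatS_trig_eq_span
      by (simp add: hat.span_add hat.span_scale)
  qed
  then show ?thesis ..
qed

subsection \<open>Bracket\<close>

lemma fst_hscale: "fst (hscale c U) = (\<lambda>x. c *s fst U x)" and snd_hscale: "snd (hscale c U) = c *s snd U"
  by (simp_all add: hscale_def)

lemma avg_scale_add:
  fixes f g :: "real^3 \<Rightarrow> complex^3"
  assumes "continuous_on UNIV f" "continuous_on UNIV g"
  shows "avg (\<lambda>x. c *s f x + g x) = c *s avg f + avg g"
proof -
  have c: "continuous_on UNIV (\<lambda>x. c *s f x)"
    by (rule bounded_linear.continuous_on[OF bounded_linear_vector_smult assms(1)])
  show ?thesis
    by (simp add: avg_add[OF c assms(2)] avg_linear[OF bounded_linear_vector_smult assms(1)])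
qed

lemma osc_scale_add:
  assumes "continuous_on UNIV u" "continuous_on UNIV w"
  shows "osc (\<lambda>x. c *s u x + w x) = (\<lambda>x. c *s osc u x + osc w x)"
  unfolding osc_def avg_scale_add[OF assms] by (simp add: fun_eq_iff vec_eq_iff algebra_simps)

lemma continuous_osc: "continuous_on UNIV u \<Longrightarrow> continuous_on UNIV (osc u)"
  unfolding osc_def by (intro continuous_intros)

lemma vbracket_scale_add:
  assumes "u differentiable (at x)" "w differentiable (at x)"
  shows "vbracket (\<lambda>x. c *s u x + w x) v x = c *s vbracket u v x + vbracket w v x"
proof -
  have "(\<lambda>y. c *s u y) differentiable (at x)"
    using bounded_linear.has_derivative[OF bounded_linear_vector_smult has_derivative_frechet[OF assms(1)]]
    unfolding differentiable_def by blast
  then have pd: "pd j (\<lambda>x. c *s u x + w x) x = c *s pd j u x + pd j w x" for j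
    by (simp add: pd_add assms pd_bounded_linear[OF bounded_linear_vector_smult])
  show ?thesis
    unfolding vbracket_def convect_def pd
    by (simp add: vec_eq_iff sum.distrib sum_distrib_left algebra_simps)
qed

lemma cocycle_scale_add:
  assumes "continuous_on UNIV u" "continuous_on UNIV w" "continuous_on UNIV v"
  shows "cocycle (\<lambda>x. c *s u x + w x) v = c *s cocycle u v + cocycle w v"
proof -
  note cont = assms[THEN continuous_osc]
  note cc = bounded_bilinear.continuous_on[OF bounded_bilinear_ccross]
  have "cocycle (\<lambda>x. c *s u x + w x) v
      = avg (\<lambda>x. c *s ccross (osc v x) (osc u x) + ccross (osc v x) (osc w x))"
    by (simp add: cocycle_def osc_scale_add[OF assms(1,2)] ccross_simps)
  also have "\<dots> = avg (\<lambda>x. c *s ccross (osc v x) (osc u x)) + cocycle w v"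
    unfolding cocycle_def
    by (intro avg_add cc cont bounded_linear.continuous_on[OF bounded_linear_vector_smult])
  also have "avg (\<lambda>x. c *s ccross (osc v x) (osc u x)) = c *s cocycle u v"
    unfolding cocycle_def by (intro avg_linear[OF bounded_linear_vector_smult] cc cont)
  finally show ?thesis .
qed

lemma hbracket_scale_add_left:
  assumes "U \<in> hatS_trig" "U' \<in> hatS_trig" "W \<in> hatS_trig"
  shows "hbracket (hscale c U + U') W = hscale c (hbracket U W) + hbracket U' W"
proof -
  have "vbracket (\<lambda>x. c *s fst U x + fst U' x) (fst W)
      = (\<lambda>x. c *s vbracket (fst U) (fst W) x + vbracket (fst U') (fst W) x)"
    by (rule ext) (rule vbracket_scale_add[OF hatS_trigD(4)[OF assms(1)] hatS_trigD(4)[OF assms(2)]])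
  then show ?thesis
    using cocycle_scale_add[OF assms[THEN hatS_trigD(3)], of c]
    by (simp add: hbracket_def prod_eq_iff plus_fun_def fst_hscale snd_hscale)
qed

lemma hbracket_anti:
  assumes "U \<in> hatS_trig" "W \<in> hatS_trig"
  shows "hbracket U W = - hbracket W U"
proof -
  have "cocycle (fst U) (fst W) = avg (\<lambda>x. - ccross (osc (fst U) x) (osc (fst W) x))"
    unfolding cocycle_def by (subst ccross_anti) simp
  also have "\<dots> = - cocycle (fst W) (fst U)"
    unfolding cocycle_def
    by (intro avg_linear bounded_linear_minus bounded_linear_ident
        bounded_bilinear.continuous_on[OF bounded_bilinear_ccross] continuous_osc
        assms[THEN hatS_trigD(3)])
  finally show ?thesis
    by (simp add: hbracket_def prod_eq_iff vbracket_def fun_eq_iff)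
qed

lemmas hatS_trig_closed = hat.subspace_0[OF subspace_hatS_trig] hat.subspace_add[OF subspace_hatS_trig]
  hat.subspace_scale[OF subspace_hatS_trig] hat.subspace_neg[OF subspace_hatS_trig]

lemma hbracket_scale_add_right:
  assumes "U \<in> hatS_trig" "U' \<in> hatS_trig" "W \<in> hatS_trig"
  shows "hbracket W (hscale c U + U') = hscale c (hbracket W U) + hbracket W U'"
  using assms
  by (simp add: hbracket_anti[of W] hbracket_scale_add_left hatS_trig_closed)

lemma hbracket_0: "U \<in> hatS_trig \<Longrightarrow> hbracket 0 U = 0" "U \<in> hatS_trig \<Longrightarrow> hbracket U 0 = 0"
  \<comment> \<open>With scalar -1 and zero vectors, the right-hand side is minus a value plus the
    same value.\<close>
  using hbracket_scale_add_left[of 0 0 U "-1"] hbracket_scale_add_right[of 0 0 U "-1"] hatS_trig_closed(1)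
  by simp_all

lemma hbracket_in_hatS_trig:
  assumes U: "U \<in> hatS_trig" and W: "W \<in> hatS_trig"
  shows "hbracket U W \<in> hatS_trig"
  using U
proof (induction rule: hatS_trig_induct)
  case zero
  then show ?case by (simp add: hbracket_0 W hatS_trig_closed)
next
  case (scale_add a U U')
  then show ?case by (simp add: hbracket_scale_add_left W hatS_trig_closed)
next
  case (wave m p c)
  note Ut = hwave_in_hatS_trig[OF wave, of c]
  show ?case
    using W
  proof (induction rule: hatS_trig_induct)
    case zero
    then show ?case by (simp add: hbracket_0 Ut hatS_trig_closed)
  next
    case (scale_add a U U')
    then show ?case by (simp add: hbracket_scale_add_right Ut hatS_trig_closed)
  next
    \<comment> \<open>Paired with the frequency m + n, the two terms of the bracket amplitude
      cancel, since p is orthogonal to m and q to n.\<close>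
    case (wave n q d)
    with \<open>cdot (kvec m) p = 0\<close> show ?case
      unfolding hbracket_hwave
      by (intro hwave_in_hatS_trig) (simp add: cdot_simps cdot_commute)
  qed
qed

section \<open>Jacobi identity\<close>

definition jacobiator :: "hat \<Rightarrow> hat \<Rightarrow> hat \<Rightarrow> hat" where
  "jacobiator x y z = hbracket x (hbracket y z) + hbracket y (hbracket z x) + hbracket z (hbracket x y)"

text \<open>Any argument can be rotated into the first slot, so linearity has to be established
  there only.\<close>

lemma jacobiator_rotate: "jacobiator x y z = jacobiator y z x"
  by (simp add: jacobiator_def ac_simps)

lemma jacobiator_scale_add:
  assumes "x \<in> hatS_trig" "x' \<in> hatS_trig" "y \<in> hatS_trig" "z \<in> hatS_trig"
  shows "jacobiator (hscale c x + x') y z = hscale c (jacobiator x y z) + jacobiator x' y z"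
  using assms
  by (simp add: jacobiator_def hbracket_scale_add_left hbracket_scale_add_right hbracket_in_hatS_trig
      hat.scale_right_distrib)

lemma jacobiator_0: "y \<in> hatS_trig \<Longrightarrow> z \<in> hatS_trig \<Longrightarrow> jacobiator 0 y z = 0"
  by (simp add: jacobiator_def hbracket_0 hbracket_in_hatS_trig)

text \<open>The field component is the Jacobi identity for the bracket amplitudes \<open>s\<close>.
  The central component can be nonzero only when the three frequencies add up to 0, and there it is
  the 2-cocycle identity.\<close>

lemma jacobiator_hwave:
  assumes p: "cdot (kvec m) p = 0" and q: "cdot (kvec n) q = 0" and r: "cdot (kvec l) r = 0"
  shows "jacobiator (hwave m p c) (hwave n q d) (hwave l r e) = 0"
proof -
  define s where "s m p n q = \<i> *s (cdot p (kvec n) *s q - cdot q (kvec m) *s p)" for m p n q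
  have sb: "hbracket (hwave m p c) (hwave n q d)
      = hwave (m + n) (s m p n q) (if m + n = 0 \<and> m \<noteq> 0 then ccross q p else 0)" for m p c n q d
    by (simp only: hbracket_hwave s_def)
  have br: "hbracket (hwave m p c) (hbracket (hwave n q d) (hwave l r e))
      = hwave (m + n + l) (s m p (n + l) (s n q l r)) (if m + n + l = 0 then ccross (s n q l r) p else 0)"
    if "cdot (kvec n) q = 0" "cdot (kvec l) r = 0" for m p c n q d l r e
  proof -
    have "s n q l r = 0" if "m + n + l = 0" "m = 0"
    proof -
      have "l = - n" using that by (simp add: eq_neg_iff_add_eq_0 add.commute)
      then show ?thesis
        using \<open>cdot (kvec n) q = 0\<close> \<open>cdot (kvec l) r = 0\<close> by (simp add: s_def cdot_commute cdot_simps)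
    qed
    then show ?thesis
      unfolding sb by (auto simp: add.assoc ccross_simps)
  qed
  let ?i = "m + n + l"
  have i: "n + l + m = ?i" "l + m + n = ?i" by (simp_all add: ac_simps)
  have field: "s m p (n + l) (s n q l r) + s n q (l + m) (s l r m p) + s l r (m + n) (s m p n q) = 0"
    by (simp add: s_def cdot_simps vec_eq_iff algebra_simps)
  \<comment> \<open>The third frequency is eliminated; its transversality to r becomes the relation
    \<open>rn\<close>, after which all terms are multiples of three cross products and
    cancel.\<close>
  have center: "ccross (s n q l r) p + ccross (s l r m p) q + ccross (s m p n q) r = 0" if "?i = 0"
  proof -
    have l: "kvec l = - kvec m - kvec n"
    proof -
      have "l = - (m + n)" using that by (rule add_eq_0_iff[THEN iffD1])
      then show ?thesis by simp
    qed
    have rn: "cdot r (kvec n) = - cdot r (kvec m)"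
      using r unfolding l by (simp add: cdot_simps cdot_commute eq_neg_iff_add_eq_0 add.commute)
    have "cdot p (kvec m) = 0" "cdot q (kvec n) = 0"
      using p q by (simp_all add: cdot_commute)
    then show ?thesis
      unfolding s_def l
      by (simp add: cdot_simps ccross_simps rn ccross_anti[of q p] ccross_anti[of r p] ccross_anti[of r q]
          vec_eq_iff algebra_simps)
  qed
  have "jacobiator (hwave m p c) (hwave n q d) (hwave l r e)
      = hwave ?i (s m p (n + l) (s n q l r) + s n q (l + m) (s l r m p) + s l r (m + n) (s m p n q))
          (if ?i = 0 then ccross (s n q l r) p + ccross (s l r m p) q + ccross (s m p n q) r else 0)"
    unfolding jacobiator_def br[OF q r] br[OF r p] br[OF p q] i by (simp flip: hwave_add)
  then show ?thesis unfolding field using center by simp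
qed

lemma jacobiator_eq_0:
  assumes x: "x \<in> hatS_trig" and y: "y \<in> hatS_trig" and z: "z \<in> hatS_trig"
  shows "jacobiator x y z = 0"
proof -
  have 1: "jacobiator (hwave m p c) (hwave n q d) z = 0"
    if "z \<in> hatS_trig" and p: "cdot (kvec m) p = 0" and q: "cdot (kvec n) q = 0" for m p c n q d z
    unfolding jacobiator_rotate[of _ _ z] jacobiator_rotate[of _ z]
    using that(1)
  proof (induction rule: hatS_trig_induct)
    case (wave l r e)
    then show ?case
      using jacobiator_hwave[OF wave p q] by simp
  qed (simp_all add: jacobiator_scale_add jacobiator_0 hwave_in_hatS_trig p q)
  have 2: "jacobiator (hwave m p c) y z = 0"
    if "y \<in> hatS_trig" and z: "z \<in> hatS_trig" and p: "cdot (kvec m) p = 0" for m p c y z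
    unfolding jacobiator_rotate[of _ y]
    using that(1)
  proof (induction rule: hatS_trig_induct)
    case (wave n q d)
    show ?case
      using 1[OF z p wave, of c d] unfolding jacobiator_rotate[of "hwave m p c"] .
  qed (simp_all add: jacobiator_scale_add jacobiator_0 hwave_in_hatS_trig p z)
  show ?thesis
    using x by (induction rule: hatS_trig_induct)
      (simp_all add: jacobiator_scale_add jacobiator_0 2 y z)
qed

lemma bilinear_onI:
  assumes V: "module.subspace s V" and s: "module s" and t: "module t"
    and left: "\<And>c x y z. x \<in> V \<Longrightarrow> y \<in> V \<Longrightarrow> z \<in> V \<Longrightarrow> f (s c x + y) z = t c (f x z) + f y z"
    and right: "\<And>c x y z. x \<in> V \<Longrightarrow> y \<in> V \<Longrightarrow> z \<in> V \<Longrightarrow> f z (s c x + y) = t c (f z x) + f z y"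
  shows "bilinear_on s t V f"
proof -
  interpret s: module s by (rule s)
  interpret t: module t by (rule t)
  note 0 = s.subspace_0[OF V]
  have add: "f (x + y) z = f x z + f y z" "f z (x + y) = f z x + f z y" if "x \<in> V" "y \<in> V" "z \<in> V" for x y z
    using left[OF that, of 1] right[OF that, of 1] by simp_all
  then have "f 0 z = 0" "f z 0 = 0" if "z \<in> V" for z
    using add[OF 0 0 that] by simp_all
  then have "f (s c x) y = t c (f x y)" "f x (s c y) = t c (f x y)" if "x \<in> V" "y \<in> V" for c x y
    using left[OF that(1) 0 that(2), of c] right[OF that(2) 0 that(1), of c] that by simp_all
  with add show ?thesis unfolding bilinear_on_def by blast
qed

lemma lie_algebra_hatS_trig: "lie_algebra_on hscale hatS_trig hbracket"
  unfolding lie_algebra_on_def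
proof (intro conjI ballI)
  show "bilinear_on hscale hscale hatS_trig hbracket"
    using hbracket_scale_add_left hbracket_scale_add_right
    by (intro bilinear_onI subspace_hatS_trig hat.module_axioms)
  show "hbracket U U = 0" if "U \<in> hatS_trig" for U
  proof -
    have "hbracket U U + hbracket U U = 0"
      using hbracket_anti[OF that that] by (simp add: eq_neg_iff_add_eq_0)
    then have "hscale 2 (hbracket U U) = 0"
      using hat.scale_left_distrib[of 1 1 "hbracket U U"] by simp
    then show ?thesis by simp
  qed
  show "hbracket x (hbracket y z) + hbracket y (hbracket z x) + hbracket z (hbracket x y) = 0"
    if "x \<in> hatS_trig" "y \<in> hatS_trig" "z \<in> hatS_trig" for x y z
    using jacobiator_eq_0[OF that] by (simp add: jacobiator_def)
qed (use subspace_hatS_trig hbracket_in_hatS_trig in auto)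

subsection \<open>Inner product\<close>

text \<open>A certificate for a value of \<open>curl_inv\<close>. Potentials add and scale, and
  uniqueness transfers this to \<open>curl_inv\<close>, which as a choice function has no linearity
  of its own.\<close>

definition curl_potential :: "field \<Rightarrow> hat \<Rightarrow> bool" where
  "curl_potential v U \<longleftrightarrow> v \<in> incompressible \<and> avg v = 0 \<and> curl v = osc (fst U)"

lemma curl_inv_eq_potential: "curl_potential v U \<Longrightarrow> curl_inv (osc (fst U)) = v"
  unfolding curl_potential_def by (intro curl_inv_eqI) auto

lemma curl_potential_scale_add:
  assumes v: "curl_potential v U" and w: "curl_potential w W" and U: "U \<in> hatS_trig" and W: "W \<in> hatS_trig"
  shows "curl_potential (\<lambda>x. c *s v x + w x) (hscale c U + W)"
proof -
  have vi: "v \<in> incompressible" "avg v = 0" "curl v = osc (fst U)"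
    and wi: "w \<in> incompressible" "avg w = 0" "curl w = osc (fst W)"
    using v w by (auto simp: curl_potential_def)
  have cv: "(\<lambda>x. c *s v x) \<in> incompressible" by (rule incompressible_scale[OF vi(1)])
  have "pd j (\<lambda>x. c *s v x + w x) x = c *s pd j v x + pd j w x" for j x
    by (simp add: pd_add[OF incompressibleD(4)[OF cv] incompressibleD(4)[OF wi(1)]]
        pd_bounded_linear[OF bounded_linear_vector_smult incompressibleD(4)[OF vi(1)]])
  then have "curl (\<lambda>x. c *s v x + w x) = (\<lambda>x. c *s curl v x + curl w x)"
    by (simp add: fun_eq_iff curl_def vec_eq_iff forall_3 algebra_simps)
  moreover have "avg (\<lambda>x. c *s v x + w x) = 0"
    using avg_add[OF incompressibleD(5)[OF cv] incompressibleD(5)[OF wi(1)]]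
      avg_linear[OF bounded_linear_vector_smult incompressibleD(5)[OF vi(1)]] vi(2) wi(2)
    by simp
  moreover have "fst (hscale c U + W) = (\<lambda>x. c *s fst U x + fst W x)"
    by (simp add: plus_fun_def fst_hscale)
  ultimately show ?thesis
    using incompressible_add[OF cv wi(1)] vi(3) wi(3)
      osc_scale_add[OF hatS_trigD(3)[OF U] hatS_trigD(3)[OF W]]
    by (simp add: curl_potential_def)
qed

lemma curl_potential_exists:
  assumes "U \<in> hatS_trig"
  shows "\<exists>v. curl_potential v U"
  using assms
proof (induction rule: hatS_trig_induct)
  case zero
  have "(\<lambda>x. 0) \<in> incompressible"
    using incompressible_wave[of 0 0] by (simp add: wave_linear cdot_simps)
  moreover have "osc (fst (0 :: hat)) = (\<lambda>x. 0)"
    by (simp add: osc_def zero_fun_def)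
  ultimately show ?case using curl_0 by (auto simp: curl_potential_def)
next
  case (scale_add a U W)
  then show ?case using curl_potential_scale_add by blast
next
  case (wave m p c)
  \<comment> \<open>A constant field has zero oscillating part, hence potential 0; otherwise the
    symbol of the inverse curl is applied to the amplitude.\<close>
  let ?q = "if m = 0 then 0 else (\<i> / cdot (kvec m) (kvec m)) *s ccross (kvec m) p"
  have "wave m ?q \<in> incompressible"
    by (rule incompressible_wave) (simp add: cdot_simps cdot_ccross_same)
  moreover have "curl (wave m ?q) = osc (fst (hwave m p c))"
  proof (cases "m = 0")
    case False
    then have "\<i> *s ccross (kvec m) ?q = p"
      using ccross_kvec_inverse[OF False wave] by simp
    with False show ?thesis by (simp add: hwave_def osc_wave curl_wave)
  qed (simp add: hwave_def osc_wave wave_linear curl_0)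
  ultimately show ?case
    unfolding curl_potential_def by (intro exI[of _ "wave m ?q"]) (simp add: avg_wave)
qed

lemma pairing_eq_potential:
  "curl_potential w W \<Longrightarrow>
    pairing U W = avg (\<lambda>x. cdot (osc (fst U) x) (w x)) + cdot (snd U) (avg (fst W)) + cdot (snd W) (avg (fst U))"
  by (simp add: pairing_def curl_inv_eq_potential)

lemma avg_mult_add:
  fixes f g :: "real^3 \<Rightarrow> complex"
  assumes "continuous_on UNIV f" "continuous_on UNIV g"
  shows "avg (\<lambda>x. c * f x + g x) = c * avg f + avg g"
proof -
  have c: "continuous_on UNIV (\<lambda>x. c * f x)"
    by (intro continuous_intros assms)
  show ?thesis
    by (simp add: avg_add[OF c assms(2)] avg_linear[OF bounded_linear_mult_right assms(1)])
qed

lemma fst_scale_add: "fst (hscale c U + W) = (\<lambda>x. c *s fst U x + fst W x)"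
  by (simp add: plus_fun_def fst_hscale)

lemma pairing_scale_add:
  assumes U: "U \<in> hatS_trig" and U': "U' \<in> hatS_trig" and W: "W \<in> hatS_trig"
  shows "pairing (hscale c U + U') W = c * pairing U W + pairing U' W"
    and "pairing W (hscale c U + U') = c * pairing W U + pairing W U'"
proof -
  obtain u u' w where pot: "curl_potential u U" "curl_potential u' U'" "curl_potential w W"
    using curl_potential_exists assms by metis
  then have cont: "continuous_on UNIV u" "continuous_on UNIV u'" "continuous_on UNIV w"
    by (auto simp: curl_potential_def intro: incompressibleD(5))
  note contf = U[THEN hatS_trigD(3)] U'[THEN hatS_trigD(3)] W[THEN hatS_trigD(3)]
  note cd = bounded_bilinear.continuous_on[OF bounded_bilinear_cdot]
  have "avg (\<lambda>x. cdot (osc (\<lambda>x. c *s fst U x + fst U' x) x) (w x))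
      = c * avg (\<lambda>x. cdot (osc (fst U) x) (w x)) + avg (\<lambda>x. cdot (osc (fst U') x) (w x))"
    unfolding osc_scale_add[OF contf(1,2)] cdot_simps
    by (intro avg_mult_add cd cont contf continuous_osc)
  note e = this avg_scale_add[OF contf(1,2)]
  show "pairing (hscale c U + U') W = c * pairing U W + pairing U' W"
    unfolding pairing_eq_potential[OF pot(3)] fst_scale_add e snd_add snd_hscale cdot_simps
    by (simp add: algebra_simps)
  have "avg (\<lambda>x. cdot (osc (fst W) x) (c *s u x + u' x))
      = c * avg (\<lambda>x. cdot (osc (fst W) x) (u x)) + avg (\<lambda>x. cdot (osc (fst W) x) (u' x))"
    unfolding cdot_simps by (intro avg_mult_add cd cont contf continuous_osc)
  note e = this avg_scale_add[OF contf(1,2)]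
  show "pairing W (hscale c U + U') = c * pairing W U + pairing W U'"
    unfolding pairing_eq_potential[OF pot(1)] pairing_eq_potential[OF pot(2)]
      pairing_eq_potential[OF curl_potential_scale_add[OF pot(1,2) U U']]
      fst_scale_add e snd_add snd_hscale
    by (simp add: cdot_simps algebra_simps)
qed

section \<open>Symmetry and invariance of the inner product\<close>

lemma pairing_0: "W \<in> hatS_trig \<Longrightarrow> pairing 0 W = 0" "W \<in> hatS_trig \<Longrightarrow> pairing W 0 = 0"
  using pairing_scale_add[of 0 0 W "-1"] hatS_trig_closed(1) by simp_all

text \<open>Self-adjointness of the inverse curl: passing to the opposite frequency and exchanging
  the amplitudes in the triple product each change the sign once.\<close>

lemma pairing_sym:
  assumes U: "U \<in> hatS_trig" and W: "W \<in> hatS_trig"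
  shows "pairing U W = pairing W U"
  using U
proof (induction rule: hatS_trig_induct)
  case (wave m p c)
  note p = wave
  note Ut = hwave_in_hatS_trig[OF p, of c]
  show ?case
    using W
  proof (induction rule: hatS_trig_induct)
    case (wave n q d)
    have "\<i> / cdot (kvec n) (kvec n) * cdot p (ccross (kvec n) q)
        = \<i> / cdot (kvec m) (kvec m) * cdot q (ccross (kvec m) p)" if "m + n = 0"
    proof -
      have n: "n = - m" using that by (simp add: eq_neg_iff_add_eq_0 add.commute)
      show ?thesis
        unfolding n using cdot_ccross_rotate[of p "kvec m" q] cdot_ccross_rotate[of q "kvec m" p]
          ccross_anti[of p q]
        by (simp add: cdot_simps ccross_simps)
    qed
    then show ?case
      by (auto simp: pairing_hwave[OF wave] pairing_hwave[OF p] add.commute[of n m])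
  qed (simp_all add: pairing_scale_add pairing_0 Ut)
qed (simp_all add: pairing_scale_add pairing_0 W)

text \<open>For divergence-free fields [u, w] is the curl of w \<times> u, so the inverse curl in
  the inner product cancels and leaves the average of (w \<times> u) \<bullet> z. At l = 0 the field
  part of the bracket vanishes and the cocycle, paired with the constant z, supplies the same triple
  product, except when all frequencies are 0.\<close>

lemma pairing_hbracket_hwave:
  assumes p: "cdot (kvec m) p = 0" and q: "cdot (kvec n) q = 0" and r: "cdot (kvec l) r = 0"
  shows "pairing (hbracket (hwave m p c) (hwave n q d)) (hwave l r e)
    = (if m + n + l = 0 \<and> (m \<noteq> 0 \<or> n \<noteq> 0) then cdot (ccross q p) r else 0)"
proof -
  let ?s = "\<i> *s (cdot p (kvec n) *s q - cdot q (kvec m) *s p)"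
  have pq: "cdot p (kvec m) = 0" "cdot q (kvec n) = 0"
    using p q by (simp_all add: cdot_commute)
  have s0: "?s = 0" if "m + n = 0"
  proof -
    have "n = - m" using that by (simp add: eq_neg_iff_add_eq_0 add.commute)
    then show ?thesis using pq by (simp add: cdot_simps)
  qed
  have main: "\<i> / cdot (kvec l) (kvec l) * cdot ?s (ccross (kvec l) r) = cdot (ccross q p) r"
    if "m + n + l = 0" "l \<noteq> 0"
  proof -
    have l: "l = - (m + n)" using that(1) by (rule add_eq_0_iff[THEN iffD1])
    have "cdot p (kvec n) *s q - cdot q (kvec m) *s p = - ccross (kvec l) (ccross q p)"
      unfolding l using pq by (simp add: ccross_ccross cdot_simps cdot_commute[of "kvec _"] vec_eq_iff algebra_simps)
    then have "cdot ?s (ccross (kvec l) r) = - \<i> * cdot (ccross (kvec l) (ccross q p)) (ccross (kvec l) r)"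
      by (simp add: cdot_simps)
    also have "\<dots> = - \<i> * (cdot (kvec l) (kvec l) * cdot (ccross q p) r)"
      using r by (simp add: cdot_ccross_ccross)
    finally show ?thesis using that(2) cdot_kvec_self_eq_0[of l] by simp
  qed
  show ?thesis
    unfolding hbracket_hwave pairing_hwave[OF r]
    using main s0 by (cases "l = 0"; cases "m = 0") (auto simp: cdot_simps)
qed

lemma pairing_invariant:
  assumes x: "x \<in> hatS_trig" and y: "y \<in> hatS_trig" and z: "z \<in> hatS_trig"
  shows "pairing (hbracket x y) z = pairing x (hbracket y z)"
  using x
proof (induction rule: hatS_trig_induct)
  case (wave m p c)
  note p = wave
  note X = hwave_in_hatS_trig[OF p, of c]
  show ?case
    using y
  proof (induction rule: hatS_trig_induct)
    case (wave n q d)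
    note q = wave
    note Y = hwave_in_hatS_trig[OF q, of d]
    show ?case
      using z
    proof (induction rule: hatS_trig_induct)
      case (wave l r e)
      note r = wave
      have "pairing (hwave m p c) (hbracket (hwave n q d) (hwave l r e))
          = pairing (hbracket (hwave n q d) (hwave l r e)) (hwave m p c)"
        by (intro pairing_sym hbracket_in_hatS_trig hwave_in_hatS_trig p q r)
      moreover have "n + l + m = m + n + l" by (simp add: ac_simps)
      moreover have "cdot (ccross r q) p = cdot (ccross q p) r"
        using cdot_ccross_rotate[of p r q] by (simp add: cdot_commute)
      \<comment> \<open>The exceptional case means that all three frequencies vanish, so it is
        unaffected by the cyclic rotation.\<close>
      moreover have "m = 0 \<and> n = 0 \<longleftrightarrow> n = 0 \<and> l = 0" if "m + n + l = 0"
        using that by auto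
      ultimately show ?case
        by (auto simp: pairing_hbracket_hwave[OF p q r] pairing_hbracket_hwave[OF q r p])
    qed (simp_all add: pairing_scale_add pairing_0 hbracket_0 hbracket_scale_add_right hbracket_in_hatS_trig X Y)
  qed (simp_all add: pairing_scale_add pairing_0 hbracket_0 hbracket_scale_add_left hbracket_scale_add_right
      hbracket_in_hatS_trig X z)
qed (simp_all add: pairing_scale_add pairing_0 hbracket_0 hbracket_scale_add_left hbracket_in_hatS_trig y z)

lemma bilinear_pairing: "bilinear_on hscale (*) hatS_trig pairing"
  using pairing_scale_add by (intro bilinear_onI subspace_hatS_trig hat.module_axioms)
    (simp_all add: module_def algebra_simps)

section \<open>The Fourier elements\<close>

lemma fmode_eq: "fmode \<xi> m = hwave m (\<i> *s ccross (kvec m) (cvec \<xi>)) 0"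
  by (simp add: fmode_def hwave_def wave_def grad_emode ccross_simps ccross_anti[of "cvec \<xi>"]
      fun_eq_iff vec_eq_iff)

lemma cdot_axis: "cdot (axis j 1) v = v $ j" "cdot v (axis j 1) = v $ j"
  by (simp_all add: cdot_def axis_def if_distrib[of "\<lambda>x. x * _"] if_distrib[of "\<lambda>x. _ * x"] cong: if_cong)

lemma fmode_transversal: "cdot (kvec m) (\<i> *s ccross (kvec m) v) = 0"
  by (simp add: cdot_simps cdot_ccross_same)

lemma transl_eq: "transl j = hwave 0 (axis j 1) 0"
  by (simp add: transl_def hwave_def wave_def)

lemma central_eq: "central j = hwave 0 0 (axis j 1)"
  by (simp add: central_def hwave_def wave_linear)

lemma fmode_0 [simp]: "fmode \<xi> 0 = 0"
  by (simp add: fmode_eq ccross_simps)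

lemma basis_in_hatS_trig: "fmode \<xi> m \<in> hatS_trig" "transl j \<in> hatS_trig" "central j \<in> hatS_trig"
  by (simp_all add: fmode_eq transl_eq central_eq hwave_in_hatS_trig cdot_ccross_same cdot_simps)

lemma central_comb_eq: "central_comb n = hwave 0 0 (kvec n)"
proof -
  have "central_comb n = hwave 0 0 (of_int (n $ 1) *s axis 1 1 + (of_int (n $ 2) *s axis 2 1
      + of_int (n $ 3) *s axis 3 1))"
    using hwave_add[of 0 0 0]
    by (simp add: central_comb_def sum_3 central_eq hscale_hwave add.assoc)
  also have "of_int (n $ 1) *s axis 1 1 + (of_int (n $ 2) *s axis 2 1 + of_int (n $ 3) *s axis 3 1) = kvec n"
    by (simp add: vec_eq_iff forall_3 axis_def)
  finally show ?thesis .
qed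

section \<open>Brackets of the Fourier elements\<close>

lemma triple_of_real: "complex_of_real (\<xi> \<bullet> cross3 (rvec m) (rvec n)) = cdot (cvec \<xi>) (ccross (kvec m) (kvec n))"
  by (simp add: kvec_def ccross_cvec cdot_cvec)

lemma triple_permute:
  "cdot (ccross u a) v = - cdot a (ccross u v)" "cdot (ccross v a) u = cdot a (ccross u v)"
  by (simp_all add: cdot_def ccross_def sum_3 algebra_simps)

text \<open>Two independent direction vectors cover all three commutation relations at once. At
  opposite frequencies the central term comes from (v \<times> \<zeta>) \<times> (v \<times> \<xi>),
  which is v scaled by v \<bullet> (\<zeta> \<times> \<xi>).\<close>

lemma hbracket_fmode:
  "hbracket (fmode \<xi> m) (fmode \<zeta> n)
    = hwave (m + n) (\<i> *s (cdot (cvec \<zeta>) (ccross (kvec m) (kvec n)) *s ccross (kvec m) (cvec \<xi>)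
          + cdot (cvec \<xi>) (ccross (kvec m) (kvec n)) *s ccross (kvec n) (cvec \<zeta>)))
        (if m + n = 0 then cdot (ccross (cvec \<zeta>) (cvec \<xi>)) (kvec n) *s kvec n else 0)"
proof -
  let ?p = "\<i> *s ccross (kvec m) (cvec \<xi>)" and ?q = "\<i> *s ccross (kvec n) (cvec \<zeta>)"
  have "ccross ?q ?p = cdot (ccross (cvec \<zeta>) (cvec \<xi>)) (kvec n) *s kvec n" if "m + n = 0"
  proof -
    have m: "m = - n" using that by (simp add: eq_neg_iff_add_eq_0)
    show ?thesis
      unfolding m by (simp add: ccross_def cdot_def vec_eq_iff forall_3 sum_3 algebra_simps)
  qed
  moreover have "\<i> *s (cdot ?p (kvec n) *s ?q - cdot ?q (kvec m) *s ?p)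
      = \<i> *s (cdot (cvec \<zeta>) (ccross (kvec m) (kvec n)) *s ccross (kvec m) (cvec \<xi>)
          + cdot (cvec \<xi>) (ccross (kvec m) (kvec n)) *s ccross (kvec n) (cvec \<zeta>))"
    unfolding cdot_simps triple_permute(1)[of "kvec m" "cvec \<xi>" "kvec n"]
      triple_permute(2)[of "kvec n" "cvec \<zeta>" "kvec m"]
    by (simp add: vec_eq_iff algebra_simps)
  ultimately show ?thesis
    unfolding fmode_eq hbracket_hwave by (auto simp: cdot_simps)
qed

lemma hbracket_fmode_same:
  "hbracket (fmode \<xi> m) (fmode \<xi> n) = hscale (of_real (\<xi> \<bullet> cross3 (rvec m) (rvec n))) (fmode \<xi> (m + n))"
  unfolding hbracket_fmode triple_of_real
  unfolding fmode_eq hscale_hwave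
  by (simp add: ccross_simps cdot_simps vector_smult_assoc vector_add_ldistrib mult.commute)

text \<open>The amplitude of the mixed bracket is resolved along (u + v) \<times> a and (u + v)
  \<times> b. Crossing g \<times> (u \<times> v) with a, and using that g is orthogonal to a,
  expresses u \<times> a by (u + v) \<times> a up to a multiple of g; likewise for v \<times> b. The
  two multiples of g cancel in the weighted sum.\<close>

lemma mixed_bracket_identity:
  fixes a b u v :: "complex^3"
  defines "g \<equiv> ccross b a" and "N \<equiv> ccross u v"
  shows "cdot g (u + v) *s (cdot b N *s ccross u a + cdot a N *s ccross v b)
    = (cdot g u * cdot b N) *s ccross (u + v) a + (cdot g v * cdot a N) *s ccross (u + v) b"
proof -
  have gN: "ccross g N = cdot g v *s u - cdot g u *s v"
    unfolding N_def by (rule ccross_ccross)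
  have "cdot a g = 0" "cdot b g = 0"
    unfolding g_def by (simp_all add: cdot_ccross_same)
  then have ga: "ccross (ccross g N) a = - (cdot a N *s g)" and gb: "ccross (ccross g N) b = - (cdot b N *s g)"
    by (simp_all add: ccross_anti[of "ccross g N"] ccross_ccross)
  have a: "cdot g (u + v) *s ccross u a = cdot g u *s ccross (u + v) a - cdot a N *s g"
    using ga unfolding gN by (simp add: ccross_simps cdot_simps vec_eq_iff algebra_simps)
  have b: "cdot g (u + v) *s ccross v b = cdot g v *s ccross (u + v) b + cdot b N *s g"
    using gb unfolding gN by (simp add: ccross_simps cdot_simps vec_eq_iff algebra_simps)
  have "cdot g (u + v) *s (cdot b N *s ccross u a + cdot a N *s ccross v b)
      = cdot b N *s (cdot g (u + v) *s ccross u a) + cdot a N *s (cdot g (u + v) *s ccross v b)"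
    by (simp add: vector_smult_assoc vector_add_ldistrib mult_ac)
  also have "\<dots> = (cdot g u * cdot b N) *s ccross (u + v) a + (cdot g v * cdot a N) *s ccross (u + v) b"
    unfolding a b by (simp add: vec_eq_iff algebra_simps)
  finally show ?thesis .
qed

lemma hbracket_fmode_mixed:
  assumes gamma: "\<gamma> = cross3 \<beta> \<alpha>" and nonres: "\<And>m. m \<noteq> 0 \<Longrightarrow> \<gamma> \<bullet> rvec m \<noteq> 0"
  shows "hbracket (fmode \<alpha> m) (fmode \<beta> n)
        = hscale (of_real ((\<gamma> \<bullet> rvec m) / (\<gamma> \<bullet> rvec (m + n)) * (\<beta> \<bullet> cross3 (rvec m) (rvec n))))
            (fmode \<alpha> (m + n))
        + hscale (of_real ((\<gamma> \<bullet> rvec n) / (\<gamma> \<bullet> rvec (m + n)) * (\<alpha> \<bullet> cross3 (rvec m) (rvec n))))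
            (fmode \<beta> (m + n))
        + hscale (of_real (\<gamma> \<bullet> rvec n) * (if m + n = 0 then 1 else 0)) (central_comb n)"
proof -
  define a b g where "a = cvec \<alpha>" "b = cvec \<beta>" "g = ccross b a"
  note abg = this
  have g: "complex_of_real (\<gamma> \<bullet> rvec k) = cdot g (kvec k)" for k
    by (simp add: abg gamma kvec_def ccross_cvec cdot_cvec)
  show ?thesis
  proof (cases "m + n = 0")
    \<comment> \<open>Here \<gamma> \<bullet> rvec (m + n) = 0, so both fractions have the default
      value 0; this is harmless since \<open>fmode\<close> vanishes at frequency 0. Only the central
      term survives, as m \<times> n = 0.\<close>
    case True
    then have m: "m = - n" by (simp add: eq_neg_iff_add_eq_0)
    have "cdot w (ccross (kvec m) (kvec n)) = 0" for w
      unfolding m by (simp add: ccross_simps cdot_simps)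
    then show ?thesis
      using True
      by (simp add: hbracket_fmode g central_comb_eq hscale_hwave hat.scale_zero_left flip: abg)
  next
    case False
    let ?G = "cdot g (kvec (m + n))"
    have G: "?G \<noteq> 0" using nonres[OF False] g[of "m + n"] by (metis of_real_eq_0_iff)
    let ?N = "ccross (kvec m) (kvec n)"
    have "?G *s (cdot b ?N *s ccross (kvec m) a + cdot a ?N *s ccross (kvec n) b)
        = (cdot g (kvec m) * cdot b ?N) *s ccross (kvec (m + n)) a
          + (cdot g (kvec n) * cdot a ?N) *s ccross (kvec (m + n)) b"
      unfolding abg(3) kvec_simps by (rule mixed_bracket_identity)
    from arg_cong[OF this, of "(*s) (\<i> / ?G)"] G
    have "\<i> *s (cdot b ?N *s ccross (kvec m) a + cdot a ?N *s ccross (kvec n) b)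
        = (cdot g (kvec m) / ?G * cdot b ?N) *s (\<i> *s ccross (kvec (m + n)) a)
          + (cdot g (kvec n) / ?G * cdot a ?N) *s (\<i> *s ccross (kvec (m + n)) b)"
      by (simp add: vector_smult_assoc vector_add_ldistrib mult_ac)
    then have "hbracket (fmode \<alpha> m) (fmode \<beta> n)
        = hwave (m + n) ((cdot g (kvec m) / ?G * cdot b ?N) *s (\<i> *s ccross (kvec (m + n)) a)
          + (cdot g (kvec n) / ?G * cdot a ?N) *s (\<i> *s ccross (kvec (m + n)) b)) 0"
      unfolding hbracket_fmode abg(1,2)[symmetric] by (simp only: False if_False)
    also have "\<dots> = hscale (cdot g (kvec m) / ?G * cdot b ?N) (fmode \<alpha> (m + n))
        + hscale (cdot g (kvec n) / ?G * cdot a ?N) (fmode \<beta> (m + n))"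
      unfolding fmode_eq hscale_hwave abg(1,2)[symmetric] hwave_add[symmetric] by simp
    also have "cdot g (kvec m) / ?G * cdot b ?N
        = of_real ((\<gamma> \<bullet> rvec m) / (\<gamma> \<bullet> rvec (m + n)) * (\<beta> \<bullet> cross3 (rvec m) (rvec n)))"
      by (simp only: of_real_mult of_real_divide g triple_of_real abg(1,2))
    also have "cdot g (kvec n) / ?G * cdot a ?N
        = of_real ((\<gamma> \<bullet> rvec n) / (\<gamma> \<bullet> rvec (m + n)) * (\<alpha> \<bullet> cross3 (rvec m) (rvec n)))"
      by (simp only: of_real_mult of_real_divide g triple_of_real abg(1,2))
    finally show ?thesis
      using False by (simp only: if_False mult_zero_right hat.scale_zero_left add_0_right)
  qed
qed

lemma hbracket_transl:
  "hbracket (transl j) (fmode \<xi> m) = hscale (\<i> * of_int (m $ j)) (fmode \<xi> m)"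
  "hbracket (transl j) (transl k) = 0"
  by (simp_all add: transl_eq fmode_eq hbracket_hwave cdot_simps cdot_axis hscale_hwave
      vector_smult_assoc mult_ac)

lemma hbracket_central:
  "hbracket (central j) U = 0" "hbracket U (central j) = 0"
  by (simp_all add: hbracket_def central_def vbracket_def convect_def cocycle_def osc_def ccross_simps
      zero_prod_def zero_fun_def)

text \<open>\<open>fmode \<zeta> n\<close> is the curl of \<open>cvec \<zeta>\<close> times
  \<open>emode n\<close>, so its inverse curl has amplitude \<open>cvec \<zeta>\<close> up to a
  component along n, which is orthogonal to the other amplitude. For \<xi> = \<zeta> the triple
  product degenerates, whence isotropy.\<close>

lemma pairing_fmode:
  "pairing (fmode \<xi> m) (fmode \<zeta> n)
    = (if m + n = 0 then \<i> * of_real (cross3 \<zeta> \<xi> \<bullet> rvec n) else 0)"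
proof -
  let ?v = "kvec n" and ?a = "cvec \<xi>" and ?b = "cvec \<zeta>"
  have "\<i> / cdot ?v ?v * cdot (\<i> *s ccross (kvec m) ?a) (ccross ?v (\<i> *s ccross ?v ?b))
      = \<i> * cdot (ccross ?b ?a) ?v" if "m + n = 0" "n \<noteq> 0"
  proof -
    have m: "m = - n" using that by (simp add: eq_neg_iff_add_eq_0)
    have "cdot (ccross ?v ?a) ?v = 0" by (simp add: cdot_commute cdot_ccross_same)
    moreover have "cdot (ccross ?v ?a) ?b = - cdot (ccross ?b ?a) ?v"
      by (simp add: ccross_def cdot_def sum_3 algebra_simps)
    ultimately show ?thesis
      using that(2) cdot_kvec_self_eq_0[of n]
      by (simp add: m cdot_simps ccross_simps ccross_ccross)
  qed
  moreover have "cdot (ccross ?b ?a) ?v = of_real (cross3 \<zeta> \<xi> \<bullet> rvec n)"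
    by (simp add: kvec_def ccross_cvec cdot_cvec)
  ultimately show ?thesis
    unfolding fmode_eq pairing_hwave[OF fmode_transversal] by (auto simp: cdot_simps)
qed

lemma pairing_basis:
  "pairing (fmode \<xi> m) (central j) = 0" "pairing (central j) (fmode \<xi> m) = 0"
  "pairing (fmode \<xi> m) (transl j) = 0" "pairing (transl j) (fmode \<xi> m) = 0"
  "pairing (central j) (central k) = 0" "pairing (transl j) (transl k) = 0"
  "pairing (transl j) (central k) = (if j = k then 1 else 0)"
  "pairing (central j) (transl k) = (if j = k then 1 else 0)"
  by (simp_all add: fmode_eq transl_eq central_eq pairing_hwave cdot_ccross_same cdot_simps cdot_axis
      ccross_simps) (auto simp: axis_def)

text \<open>For p orthogonal to k, the vector k \<times> (p \<times> g) is p scaled by k \<bullet>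
  g, while p \<times> g with g = b \<times> a is a combination of a and b. So p is a combination of
  k \<times> a and k \<times> b, with denominator g \<bullet> k. An arbitrary subspace
  \<open>S\<close> lets the result serve both the dual families and the unnormalised basis.\<close>

lemma hatS_trig_subset_if_basis:
  assumes gamma: "\<gamma> = cross3 \<beta> \<alpha>" and nonres: "\<And>m. m \<noteq> 0 \<Longrightarrow> \<gamma> \<bullet> rvec m \<noteq> 0"
    and S: "hat.subspace S"
    and modes: "\<And>m. m \<noteq> 0 \<Longrightarrow> fmode \<alpha> m \<in> S" "\<And>m. m \<noteq> 0 \<Longrightarrow> fmode \<beta> m \<in> S"
    and constant_fields: "\<And>j. transl j \<in> S" "\<And>j. central j \<in> S"
  shows "hatS_trig \<subseteq> S"
proof -
  note closed = hat.subspace_add[OF S] hat.subspace_scale[OF S]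
  have axes: "v = v $ 1 *s axis 1 1 + (v $ 2 *s axis 2 1 + v $ 3 *s axis 3 1)" for v :: "complex^3"
    by (simp add: vec_eq_iff forall_3 axis_def)
  have center: "hwave m 0 c \<in> S" for m c
  proof -
    have "hwave m 0 c = hwave 0 0 (c $ 1 *s axis 1 1 + (c $ 2 *s axis 2 1 + c $ 3 *s axis 3 1))"
      by (subst axes[symmetric]) (rule hwave_zero_amplitude)
    also have "\<dots> = hscale (c $ 1) (central 1) + (hscale (c $ 2) (central 2) + hscale (c $ 3) (central 3))"
      by (simp add: central_eq hscale_hwave flip: hwave_add)
    finally show ?thesis by (simp add: closed constant_fields)
  qed
  have field: "hwave m p 0 \<in> S" if p: "cdot (kvec m) p = 0" for m p
  proof (cases "m = 0")
    case True
    have "hwave m p 0 = hwave 0 (p $ 1 *s axis 1 1 + (p $ 2 *s axis 2 1 + p $ 3 *s axis 3 1)) 0"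
      unfolding True by (subst axes[symmetric]) (rule refl)
    also have "\<dots> = hscale (p $ 1) (transl 1) + (hscale (p $ 2) (transl 2) + hscale (p $ 3) (transl 3))"
      by (simp add: transl_eq hscale_hwave flip: hwave_add)
    finally show ?thesis by (simp add: closed constant_fields)
  next
    case False
    define a b g where "a = cvec \<alpha>" "b = cvec \<beta>" "g = ccross b a"
    note abg = this
    let ?k = "kvec m"
    have "complex_of_real (\<gamma> \<bullet> rvec m) = cdot g ?k"
      by (simp add: abg gamma kvec_def ccross_cvec cdot_cvec)
    with nonres[OF False] have G: "cdot g ?k \<noteq> 0" by (metis of_real_eq_0_iff)
    have "ccross ?k (ccross p g) = cdot ?k g *s p"
      using p by (simp add: ccross_ccross)
    moreover have "ccross p g = cdot p a *s b - cdot p b *s a"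
      unfolding abg(3) by (rule ccross_ccross)
    ultimately have "cdot g ?k *s p = cdot p a *s ccross ?k b - cdot p b *s ccross ?k a"
      by (simp add: ccross_simps cdot_commute[of g])
    from arg_cong[OF this, of "(*s) (1 / cdot g ?k)"] G
    have "p = (1 / cdot g ?k) *s (cdot p a *s ccross ?k b - cdot p b *s ccross ?k a)"
      by (simp add: vector_smult_assoc)
    also have "\<dots> = (\<i> * cdot p b / cdot g ?k) *s (\<i> *s ccross ?k a)
        + (- \<i> * cdot p a / cdot g ?k) *s (\<i> *s ccross ?k b)"
      using G by (simp add: vec_eq_iff field_simps)
    finally have "hwave m p 0 = hscale (\<i> * cdot p b / cdot g ?k) (fmode \<alpha> m)
        + hscale (- \<i> * cdot p a / cdot g ?k) (fmode \<beta> m)"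
      unfolding fmode_eq hscale_hwave abg(1,2)[symmetric] by (simp flip: hwave_add)
    then show ?thesis using modes[OF False] by (simp add: closed hat.subspace_diff[OF S])
  qed
  have "hwave m p c \<in> S" if "cdot (kvec m) p = 0" for m p c
    using closed(1)[OF field[OF that] center[of m c]] by (simp flip: hwave_add)
  then show ?thesis
    unfolding hatS_trig_eq_span
    by (intro hat.span_minimal[OF _ S]) (auto simp: solenoidal_waves_def)
qed

section \<open>Dual families on the torus\<close>

lemma indices_cases:
  assumes "a \<in> indices"
  obtains (mode) m where "a = Mode m" "m \<noteq> 0" | (axis) j where "a = Axis j"
  using assms unfolding indices_def by blast

lemma mem_indices [simp]: "Mode m \<in> indices \<longleftrightarrow> m \<noteq> 0" "Axis j \<in> indices"
  by (auto simp: indices_def)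

lemma Xlow_simps [simp]: "Xlow \<alpha> (Mode m) = fmode \<alpha> m" "Xlow \<alpha> (Axis j) = central j"
  by (simp_all add: Xlow_def)

text \<open>The sign of the normalisation is absorbed by -1 / \<i> = \<i>.\<close>

lemma Xup_simps [simp]:
  "Xup \<beta> \<gamma> (Mode n) = hscale (\<i> / of_real (\<gamma> \<bullet> rvec n)) (fmode \<beta> (- n))"
  "Xup \<beta> \<gamma> (Axis j) = transl j"
  by (simp_all add: Xup_def divide_inverse)

lemma pairing_scale:
  assumes "U \<in> hatS_trig" "W \<in> hatS_trig"
  shows "pairing (hscale c U) W = c * pairing U W" "pairing U (hscale c W) = c * pairing U W"
  using bilinear_onD(3,4)[OF bilinear_pairing assms assms(1)] by simp_all

lemma hbracket_scale:
  assumes "U \<in> hatS_trig" "W \<in> hatS_trig"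
  shows "hbracket (hscale c U) W = hscale c (hbracket U W)" "hbracket U (hscale c W) = hscale c (hbracket U W)"
  using hbracket_scale_add_left[OF assms(1) hatS_trig_closed(1) assms(2), of c]
    hbracket_scale_add_right[OF assms(2) hatS_trig_closed(1) assms(1), of c]
  by (simp_all add: hbracket_0 assms)

lemmas basis_scale = pairing_scale hbracket_scale hatS_trig_closed basis_in_hatS_trig

lemma dual_subalgebras_torus:
  fixes \<alpha> \<beta> \<gamma> :: "real^3"
  assumes gamma: "\<gamma> = cross3 \<beta> \<alpha>" and nonres: "\<And>m. m \<noteq> 0 \<Longrightarrow> \<gamma> \<bullet> rvec m \<noteq> 0"
  shows "dual_subalgebras hscale hatS_trig hbracket pairing indices (Xlow \<alpha>) (Xup \<beta> \<gamma>) (Gam \<alpha>) (Mu \<beta> \<gamma>)"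
proof unfold_locales
  note simps = basis_scale pairing_basis hbracket_central hbracket_transl hbracket_fmode_same pairing_0 hbracket_0
  have ab: "pairing (fmode \<alpha> m) (fmode \<beta> n) = (if m + n = 0 then \<i> * of_real (\<gamma> \<bullet> rvec n) else 0)" for m n
    by (simp add: pairing_fmode gamma)
  have ba: "pairing (fmode \<beta> n) (fmode \<alpha> m) = (if m + n = 0 then - (\<i> * of_real (\<gamma> \<bullet> rvec m)) else 0)" for m n
    using pairing_sym[OF basis_in_hatS_trig(1) basis_in_hatS_trig(1)] ab by (auto simp: add_eq_0_iff)
  have same: "pairing (fmode \<xi> m) (fmode \<xi> n) = 0" for \<xi> m n
    by (simp add: pairing_fmode cross_refl)
  have XV: "Xlow \<alpha> a \<in> hatS_trig" and YV: "Xup \<beta> \<gamma> a \<in> hatS_trig" if "a \<in> indices" for a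
    using that by (auto elim!: indices_cases simp: basis_scale)
  show "lie_algebra_on hscale hatS_trig hbracket" by (rule lie_algebra_hatS_trig)
  show "bilinear_on hscale (*) hatS_trig pairing" by (rule bilinear_pairing)
  show "pairing x y = pairing y x" if "x \<in> hatS_trig" "y \<in> hatS_trig" for x y
    using that by (rule pairing_sym)
  show "pairing (hbracket x y) z = pairing x (hbracket y z)"
    if "x \<in> hatS_trig" "y \<in> hatS_trig" "z \<in> hatS_trig" for x y z
    using that by (rule pairing_invariant)
  show "Xlow \<alpha> a \<in> hatS_trig" "Xup \<beta> \<gamma> a \<in> hatS_trig" if "a \<in> indices" for a
    using XV[OF that] YV[OF that] .
  show "pairing (Xlow \<alpha> a) (Xlow \<alpha> b) = 0" if "a \<in> indices" "b \<in> indices" for a b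
    using that by (auto elim!: indices_cases simp: simps same)
  show "pairing (Xup \<beta> \<gamma> a) (Xup \<beta> \<gamma> b) = 0" if "a \<in> indices" "b \<in> indices" for a b
    using that by (auto elim!: indices_cases simp: simps same)
  have mode_dual: "pairing (fmode \<alpha> m) (Xup \<beta> \<gamma> (Mode n)) = (if m = n then 1 else 0)" if "n \<noteq> 0" for m n
    using nonres[OF that] by (simp add: basis_scale ab)
  show dual: "pairing (Xlow \<alpha> a) (Xup \<beta> \<gamma> b) = (if a = b then 1 else 0)"
    if "a \<in> indices" "b \<in> indices" for a b
    using that
    by (auto elim!: indices_cases simp: mode_dual simp del: Xup_simps(1))
      (auto simp: simps split: if_splits)
  let ?S = "hat.span (Xlow \<alpha> ` indices \<union> Xup \<beta> \<gamma> ` indices)"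
  have XS: "Xlow \<alpha> a \<in> ?S" and YS: "Xup \<beta> \<gamma> a \<in> ?S" if "a \<in> indices" for a
    using that by (auto intro: hat.span_base)
  show "?S = hatS_trig"
  proof
    show "?S \<subseteq> hatS_trig"
      using XV YV by (intro hat.span_minimal[OF _ subspace_hatS_trig]) auto
    show "hatS_trig \<subseteq> ?S"
    proof (rule hatS_trig_subset_if_basis[OF gamma nonres hat.subspace_span])
      show "fmode \<alpha> m \<in> ?S" if "m \<noteq> 0" for m using XS[of "Mode m"] that by simp
      show "fmode \<beta> m \<in> ?S" if "m \<noteq> 0" for m
      proof -
        \<comment> \<open>The dual element with index - m has frequency m, and the scalar undoes its
          normalisation.\<close>
        have "fmode \<beta> m = hscale (\<i> * of_real (\<gamma> \<bullet> rvec m)) (Xup \<beta> \<gamma> (Mode (- m)))"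
          using nonres[OF that] by simp
        then show ?thesis using YS[of "Mode (- m)"] that by (metis hat.span_scale mem_indices(1) neg_equal_0_iff_equal)
      qed
      show "transl j \<in> ?S" for j using YS[of "Axis j"] by simp
      show "central j \<in> ?S" for j using XS[of "Axis j"] by simp
    qed
  qed
  show "hbracket (Xlow \<alpha> a) (Xlow \<alpha> b) \<in> hat.span (Xlow \<alpha> ` indices)"
    if "a \<in> indices" "b \<in> indices" for a b
  proof -
    \<comment> \<open>Frequency 0 is included because m + n may vanish; the element is then
      0.\<close>
    have "fmode \<alpha> m \<in> hat.span (Xlow \<alpha> ` indices)" for m
    proof (cases "m = 0")
      case False
      then show ?thesis using hat.span_base[OF imageI[of "Mode m" indices "Xlow \<alpha>"]] by simp
    qed (simp add: hat.span_zero)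
    then show ?thesis
      using that by (auto elim!: indices_cases simp: simps hat.span_scale hat.span_zero)
  qed
  show "hbracket (Xup \<beta> \<gamma> a) (Xup \<beta> \<gamma> b) \<in> hat.span (Xup \<beta> \<gamma> ` indices)"
    if "a \<in> indices" "b \<in> indices" for a b
  proof -
    have fm: "fmode \<beta> m \<in> hat.span (Xup \<beta> \<gamma> ` indices)" for m
    proof (cases "m = 0")
      case False
      then have "Xup \<beta> \<gamma> (Mode (- m)) \<in> hat.span (Xup \<beta> \<gamma> ` indices)"
        by (intro hat.span_base imageI) simp
      then have "hscale (\<i> * of_real (\<gamma> \<bullet> rvec m)) (Xup \<beta> \<gamma> (Mode (- m))) \<in> hat.span (Xup \<beta> \<gamma> ` indices)"
        by (rule hat.span_scale)
      then show ?thesis using nonres[OF False] by simp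
    qed (simp add: hat.span_zero)
    have "hbracket (fmode \<beta> m) (transl j) \<in> hat.span (Xup \<beta> \<gamma> ` indices)" for m j
      using hbracket_anti[of "fmode \<beta> m" "transl j"] fm[of m]
      by (simp add: simps hat.span_scale hat.span_neg)
    then show ?thesis
      using that fm by (auto elim!: indices_cases simp: simps hat.span_scale hat.span_neg hat.span_zero)
  qed
  show "pairing (hbracket (Xlow \<alpha> a) (Xlow \<alpha> b)) (Xup \<beta> \<gamma> c) = Gam \<alpha> a b c"
    if "a \<in> indices" "b \<in> indices" "c \<in> indices" for a b c
    using that
    by (auto elim!: indices_cases simp: simps(5-) pairing_basis hbracket_central mode_dual
        pairing_scale basis_in_hatS_trig YV simp del: Xup_simps(1))
  show "pairing (hbracket (Xup \<beta> \<gamma> a) (Xup \<beta> \<gamma> b)) (Xlow \<alpha> c) = Mu \<beta> \<gamma> a b c"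
    if "a \<in> indices" "b \<in> indices" "c \<in> indices" for a b c
  proof -
    \<comment> \<open>The dual element with index n carries frequency - n, which accounts for the
      minus sign in \<open>Mu\<close>.\<close>
    have 1: "pairing (hbracket (transl j) (Xup \<beta> \<gamma> (Mode n))) (fmode \<alpha> k) = (if k = n then - \<i> * of_int (n $ j) else 0)"
      if "n \<noteq> 0" for j n k
      using nonres[OF that] by (auto simp: simps ba add_eq_0_iff2)
    have 2: "pairing (hbracket (Xup \<beta> \<gamma> (Mode n)) (transl j)) (fmode \<alpha> k) = (if k = n then \<i> * of_int (n $ j) else 0)"
      if "n \<noteq> 0" for j n k
    proof -
      have m: "Xup \<beta> \<gamma> (Mode n) \<in> hatS_trig" using that by (intro YV) simp
      have "pairing (hbracket (Xup \<beta> \<gamma> (Mode n)) (transl j)) (fmode \<alpha> k)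
          = pairing (hscale (-1) (hbracket (transl j) (Xup \<beta> \<gamma> (Mode n)))) (fmode \<alpha> k)"
        using hbracket_anti[OF m basis_in_hatS_trig(2)[of j]] by (simp del: Xup_simps)
      also have "\<dots> = - pairing (hbracket (transl j) (Xup \<beta> \<gamma> (Mode n))) (fmode \<alpha> k)"
        using m by (subst pairing_scale) (simp_all add: hbracket_in_hatS_trig basis_in_hatS_trig del: Xup_simps)
      finally show ?thesis using 1[OF that] by simp
    qed
    have 3: "pairing (hbracket (Xup \<beta> \<gamma> (Mode n)) (transl j)) (central k) = 0" for j n k
      using hbracket_anti[of "fmode \<beta> (- n)" "transl j"]
      by (simp add: simps flip: hat.scale_minus_left)
    have 4: "pairing (hbracket (transl j) (Xup \<beta> \<gamma> (Mode n))) (central k) = 0"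
      "pairing (hbracket (Xup \<beta> \<gamma> (Mode m)) (Xup \<beta> \<gamma> (Mode n))) (central k) = 0" for j m n k
      by (simp_all add: simps del: hat.scale_minus_left)
    show ?thesis
      using that
    proof (elim indices_cases, goal_cases)
      case (1 m n k)
      \<comment> \<open>The two normalising factors multiply to minus the inverse of (\<gamma>
        \<bullet> m) (\<gamma> \<bullet> n), and the signs of the frequencies - m and - n cancel in
        the cross product.\<close>
      then have "pairing (hbracket (Xup \<beta> \<gamma> a) (Xup \<beta> \<gamma> b)) (Xlow \<alpha> c)
         = - (of_real (\<beta> \<bullet> cross3 (rvec m) (rvec n)) * pairing (fmode \<beta> (- m + - n)) (fmode \<alpha> k)
             / (of_real (\<gamma> \<bullet> rvec n) * of_real (\<gamma> \<bullet> rvec m)))"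
        by (simp add: simps del: rvec_simps(2) hat.scale_minus_left)
      with 1 nonres[of m] nonres[of n] show ?case
        by (auto simp: ba add_eq_0_iff2 field_simps)
    qed (use 1 2 3 4 in \<open>auto simp: simps simp del: Xup_simps(1)\<close>)
  qed
qed

theorem mainTheorem1:
  fixes \<alpha> \<beta> \<gamma> :: "real^3"
  assumes gamma: "\<gamma> = cross3 \<beta> \<alpha>"
    and alpha_nonres: "\<And>m. m \<noteq> 0 \<Longrightarrow> \<alpha> \<bullet> rvec m \<noteq> 0"
    and beta_nonres: "\<And>m. m \<noteq> 0 \<Longrightarrow> \<beta> \<bullet> rvec m \<noteq> 0"
    and gamma_nonres: "\<And>m. m \<noteq> 0 \<Longrightarrow> \<gamma> \<bullet> rvec m \<noteq> 0"
  shows "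
    (basis_of (indices <+> indices)
              (case_sum (case_idx (fmode \<alpha>) central) (case_idx (fmode \<beta>) transl)) hatS_trig) \<and>
    (\<forall>m n. m \<noteq> 0 \<longrightarrow> n \<noteq> 0 \<longrightarrow>
      hbracket (fmode \<alpha> m) (fmode \<alpha> n)
        = hscale (of_real (\<alpha> \<bullet> cross3 (rvec m) (rvec n))) (fmode \<alpha> (m + n))) \<and>
    (\<forall>m n. m \<noteq> 0 \<longrightarrow> n \<noteq> 0 \<longrightarrow>
      hbracket (fmode \<beta> m) (fmode \<beta> n)
        = hscale (of_real (\<beta> \<bullet> cross3 (rvec m) (rvec n))) (fmode \<beta> (m + n))) \<and>
    (\<forall>m n. m \<noteq> 0 \<longrightarrow> n \<noteq> 0 \<longrightarrow>
      hbracket (fmode \<alpha> m) (fmode \<beta> n)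
        = hscale (of_real ((\<gamma> \<bullet> rvec m) / (\<gamma> \<bullet> rvec (m + n)) * (\<beta> \<bullet> cross3 (rvec m) (rvec n))))
            (fmode \<alpha> (m + n))
        + hscale (of_real ((\<gamma> \<bullet> rvec n) / (\<gamma> \<bullet> rvec (m + n)) * (\<alpha> \<bullet> cross3 (rvec m) (rvec n))))
            (fmode \<beta> (m + n))
        + hscale (of_real (\<gamma> \<bullet> rvec n) * (if m + n = 0 then 1 else 0)) (central_comb n)) \<and>
    (\<forall>j. \<forall>U\<in>hatS. hbracket (central j) U = 0 \<and> hbracket U (central j) = 0) \<and>
    (\<forall>j k. hbracket (transl j) (transl k) = 0) \<and>
    (\<forall>j m. m \<noteq> 0 \<longrightarrow>
      hbracket (transl j) (fmode \<alpha> m) = hscale (\<i> * of_int (m $ j)) (fmode \<alpha> m)) \<and>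
    (\<forall>j m. m \<noteq> 0 \<longrightarrow>
      hbracket (transl j) (fmode \<beta> m) = hscale (\<i> * of_int (m $ j)) (fmode \<beta> m)) \<and>
    (\<forall>m n. m \<noteq> 0 \<longrightarrow> n \<noteq> 0 \<longrightarrow> pairing (fmode \<alpha> m) (fmode \<alpha> n) = 0) \<and>
    (\<forall>m j. m \<noteq> 0 \<longrightarrow> pairing (fmode \<alpha> m) (central j) = 0) \<and>
    (\<forall>m n. m \<noteq> 0 \<longrightarrow> n \<noteq> 0 \<longrightarrow> pairing (fmode \<beta> m) (fmode \<beta> n) = 0) \<and>
    (\<forall>m j. m \<noteq> 0 \<longrightarrow> pairing (fmode \<beta> m) (transl j) = 0) \<and>
    (\<forall>m n. m \<noteq> 0 \<longrightarrow> n \<noteq> 0 \<longrightarrow>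
      pairing (fmode \<alpha> m) (fmode \<beta> n)
        = \<i> * of_real (\<gamma> \<bullet> rvec n) * (if m + n = 0 then 1 else 0)) \<and>
    (\<forall>j k. pairing (transl j) (central k) = (if j = k then 1 else 0)) \<and>
    (\<forall>m n. m \<noteq> 0 \<longrightarrow> n \<noteq> 0 \<longrightarrow>
      pairing (Xlow \<alpha> (Mode m)) (Xup \<beta> \<gamma> (Mode n)) = (if m = n then 1 else 0)) \<and>
    (manin_triple hscale hatS_trig hbracket pairing
      (hat.span (Xlow \<alpha> ` indices)) (hat.span (Xup \<beta> \<gamma> ` indices))) \<and>
    (\<forall>a\<in>indices. \<forall>b\<in>indices.
      finite {c \<in> indices. Gam \<alpha> a b c \<noteq> 0} \<and> finite {c \<in> indices. Mu \<beta> \<gamma> a b c \<noteq> 0} \<and>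
      finite {d \<in> indices. Gam \<alpha> a d b \<noteq> 0} \<and> finite {d \<in> indices. Mu \<beta> \<gamma> b d a \<noteq> 0}) \<and>
    (\<forall>a\<in>indices. \<forall>b\<in>indices.
      hbracket (Xlow \<alpha> a) (Xlow \<alpha> b) = lincomb hscale indices (\<lambda>c. Gam \<alpha> a b c) (Xlow \<alpha>)) \<and>
    (\<forall>a\<in>indices. \<forall>b\<in>indices.
      hbracket (Xup \<beta> \<gamma> a) (Xup \<beta> \<gamma> b)
        = lincomb hscale indices (\<lambda>c. Mu \<beta> \<gamma> a b c) (Xup \<beta> \<gamma>)) \<and>
    (\<forall>a\<in>indices. \<forall>b\<in>indices.
      hbracket (Xlow \<alpha> a) (Xup \<beta> \<gamma> b)
        = - lincomb hscale indices (\<lambda>d. Gam \<alpha> a d b) (Xup \<beta> \<gamma>)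
          + lincomb hscale indices (\<lambda>d. Mu \<beta> \<gamma> b d a) (Xlow \<alpha>)) \<and>
    (lie_bialgebra_constants indices (Gam \<alpha>) (Mu \<beta> \<gamma>))"
proof -
  interpret dual_subalgebras hscale hatS_trig hbracket pairing indices "Xlow \<alpha>" "Xup \<beta> \<gamma>" "Gam \<alpha>" "Mu \<beta> \<gamma>"
    by (rule dual_subalgebras_torus[OF gamma gamma_nonres])
  have basis: "basis_of (indices <+> indices)
      (case_sum (case_idx (fmode \<alpha>) central) (case_idx (fmode \<beta>) transl)) hatS_trig"
    (is "basis_of ?J ?f _")
  proof -
    have fV: "?f i \<in> hatS_trig" for i
      by (auto simp: basis_in_hatS_trig split: sum.split idx.split)
    \<comment> \<open>Each basis element is matched with the only one that pairs nontrivially with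
      it: opposite frequencies of the two families, and translations with central elements.\<close>
    let ?g = "case_sum (case_idx (\<lambda>m. fmode \<beta> (- m)) transl) (case_idx (\<lambda>n. fmode \<alpha> (- n)) central)"
    have gV: "?g i \<in> hatS_trig" for i
      by (auto simp: basis_in_hatS_trig split: sum.split idx.split)
    have pair: "pairing (?f i) (?g j) = 0 \<longleftrightarrow> i \<noteq> j" if "i \<in> ?J" "j \<in> ?J" for i j
    proof -
      \<comment> \<open>Pairing in the order b, a involves the opposite orientation; its sign is
        irrelevant because only nonvanishing on the diagonal is required.\<close>
      have "cross3 \<alpha> \<beta> = - \<gamma>" unfolding gamma by (rule cross_skew)
      then show ?thesis
        using that gamma_nonres
        by (auto elim!: indices_cases simp: pairing_basis pairing_fmode cross_refl gamma[symmetric]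
            split: if_splits)
    qed
    have sub: "?f ` ?J \<subseteq> hatS_trig" "?g ` ?J \<subseteq> hatS_trig"
      using fV gV by blast+
    note independent_if_bilinear_dual[OF hat.vector_space_axioms bilinear_pairing subspace_hatS_trig sub]
    then have "inj_on ?f ?J" "hat.independent (?f ` ?J)"
      using pair by blast+
    moreover have "hat.span (?f ` ?J) = hatS_trig"
    proof
      show "hat.span (?f ` ?J) \<subseteq> hatS_trig"
        by (rule hat.span_minimal[OF sub(1) subspace_hatS_trig])
      show "hatS_trig \<subseteq> hat.span (?f ` ?J)"
      proof (rule hatS_trig_subset_if_basis[OF gamma gamma_nonres hat.subspace_span])
        show "fmode \<alpha> m \<in> hat.span (?f ` ?J)" if "m \<noteq> 0" for m
          using that by (intro hat.span_base image_eqI[of _ _ "Inl (Mode m)"]) auto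
        show "fmode \<beta> m \<in> hat.span (?f ` ?J)" if "m \<noteq> 0" for m
          using that by (intro hat.span_base image_eqI[of _ _ "Inr (Mode m)"]) auto
        show "transl j \<in> hat.span (?f ` ?J)" for j
          by (intro hat.span_base image_eqI[of _ _ "Inr (Axis j)"]) auto
        show "central j \<in> hat.span (?f ` ?J)" for j
          by (intro hat.span_base image_eqI[of _ _ "Inl (Axis j)"]) auto
      qed
    qed
    ultimately show ?thesis by (simp add: basis_of_def)
  qed
  have modes: "pairing (fmode \<alpha> m) (fmode \<beta> n) = \<i> * of_real (\<gamma> \<bullet> rvec n) * (if m + n = 0 then 1 else 0)"
    "pairing (fmode \<xi> m) (fmode \<xi> n) = 0" for \<xi> m n
    by (simp_all add: pairing_fmode gamma cross_refl)
  have dual: "pairing (Xlow \<alpha> (Mode m)) (Xup \<beta> \<gamma> (Mode n)) = (if m = n then 1 else 0)"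
    if "m \<noteq> 0" "n \<noteq> 0" for m n
    using ip_XY[of "Mode m" "Mode n"] that by simp
  interpret dual: dual_subalgebras hscale hatS_trig hbracket pairing indices "Xup \<beta> \<gamma>" "Xlow \<alpha>" "Mu \<beta> \<gamma>" "Gam \<alpha>"
    by (rule swap_subalgebras)
  show ?thesis
    by (intro conjI allI impI ballI basis hbracket_fmode_same hbracket_fmode_mixed[OF gamma gamma_nonres]
        hbracket_central hbracket_transl modes dual pairing_basis manin bracket_XX dual.bracket_XX
        bracket_XY bialgebra)
qed

end
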